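(* Let $G$ be a non-discrete locally compact group, and let $\omega$ be a weight on $G$. Then the Dales--Żelazko conjecture holds for the algebra $M(G,\omega)$; that is, if every maximal left ideal of $M(G,\omega)$ is finitely-generated, then $M(G,\omega)$ is finite-dimensional.
   Context: A weight on a locally compact group $G$ with identity $e$ is a Borel function $\omega:G\to[1,\infty)$, bounded on compact sets, with $\omega(uv)\le\omega(u)\omega(v)$ for all $u,v\in G$ and $\omega(e)=1$. With $M(G)$ the measure algebra of complex regular Borel measures on $G$ under convolution, $M(G,\omega)=\{\mu\in M(G):\|\mu\|_\omega=\int_G\omega(t)\,\mathrm{d}|\mu|(t)<\infty\}$, a unital Banach algebra under convolution. A left ideal $I$ of a unital algebra $A$ is finitely-generated if there exist $n\in\mathbb{N}$ and $x_1,\ldots,x_n\in A$ with $I=Ax_1+\cdots+Ax_n$ (purely algebraically, no closure is taken). The Dales--Żelazko conjecture asserts that a unital Banach algebra in which every maximal left ideal is finitely-generated is finite-dimensional. *)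

theory Defs
  imports "HOL-Analysis.Analysis" "HOL-Library.Function_Algebras"
begin

text \<open>
  A locally compact group is a type of class topological_group_add (the library's
  topological groups, additive notation, \<^emph>\<open>not\<close> assumed commutative) and t2_space
  whose topology is locally compact. So \<open>s + t\<close> is the product of \<open>s\<close> and \<open>t\<close>, in this order,
  and \<open>0\<close> is the identity.
\<close>

definition weight :: "('a::topological_group_add \<Rightarrow> real) \<Rightarrow> bool" where
  "weight \<omega> \<longleftrightarrow>
     \<omega> \<in> borel_measurable borel \<and>
     (\<forall>t. 1 \<le> \<omega> t) \<and>
     (\<forall>K. compact K \<longrightarrow> bounded (\<omega> ` K)) \<and>
     (\<forall>u v. \<omega> (u + v) \<le> \<omega> u * \<omega> v) \<and>
     \<omega> 0 = 1"


section \<open>Complex Borel measures\<close>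

text \<open>
  A complex Borel measure is a countably additive set function on the Borel sets. It is extended
  by \<open>0\<close> to all other sets, so that equality of measures is equality of functions, and the linear
  structure is the pointwise one.
\<close>

definition complex_borel_measure :: "('a::topological_space set \<Rightarrow> complex) \<Rightarrow> bool" where
  "complex_borel_measure \<mu> \<longleftrightarrow>
     (\<forall>E. E \<notin> sets borel \<longrightarrow> \<mu> E = 0) \<and>
     (\<forall>A :: nat \<Rightarrow> 'a set. range A \<subseteq> sets borel \<longrightarrow> disjoint_family A \<longrightarrow>
        (\<lambda>i. \<mu> (A i)) sums \<mu> (\<Union>i. A i))"

text \<open>
  The supremum of \<open>\<Sum>\<^sub>i \<bar>\<mu>(A\<^sub>i)\<bar>\<close> over countable Borel partitions \<open>(A\<^sub>i)\<close> of \<open>E\<close>. For a complex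
  measure it is countably additive in \<open>E\<close>, so that \<open>measure_of\<close> does not collapse to the zero
  measure; the same holds for \<open>positive_variation\<close> below.
\<close>

definition total_variation :: "('a::topological_space set \<Rightarrow> complex) \<Rightarrow> 'a measure" where
  "total_variation \<mu> = measure_of UNIV (sets borel)
     (\<lambda>E. SUP A \<in> {A :: nat \<Rightarrow> 'a set. range A \<subseteq> sets borel \<and> disjoint_family A \<and> (\<Union>i. A i) = E}.
        (\<Sum>i. ennreal (cmod (\<mu> (A i)))))"

definition regular_measure :: "('a::topological_space set \<Rightarrow> complex) \<Rightarrow> bool" where
  "regular_measure \<mu> \<longleftrightarrow>
     (\<forall>E \<in> sets borel.
        emeasure (total_variation \<mu>) E =
          (INF U \<in> {U. open U \<and> E \<subseteq> U}. emeasure (total_variation \<mu>) U) \<and>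
        emeasure (total_variation \<mu>) E =
          (SUP K \<in> {K. compact K \<and> K \<in> sets borel \<and> K \<subseteq> E}. emeasure (total_variation \<mu>) K))"

text \<open>
  Integration against a complex measure, through the Jordan decompositions of its real and
  imaginary parts. The positive variation of a real measure \<open>\<nu>\<close> is
  \<open>\<nu>\<^sup>+(E) = sup {\<nu>(F) | F \<subseteq> E}\<close>; the function \<open>ennreal\<close> truncates negative values to \<open>0\<close>, which
  leaves this supremum unchanged as \<open>F = {}\<close> contributes \<open>0\<close>. The negative variation is the
  positive variation of \<open>- \<nu>\<close>.
\<close>

definition positive_variation :: "('a::topological_space set \<Rightarrow> real) \<Rightarrow> 'a measure" where
  "positive_variation \<nu> = measure_of UNIV (sets borel)
     (\<lambda>E. SUP F \<in> {F \<in> sets borel. F \<subseteq> E}. ennreal (\<nu> F))"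

definition signed_integral ::
    "('a::topological_space set \<Rightarrow> real) \<Rightarrow> ('a \<Rightarrow> complex) \<Rightarrow> complex" where
  "signed_integral \<nu> f =
     integral\<^sup>L (positive_variation \<nu>) f - integral\<^sup>L (positive_variation (\<lambda>E. - \<nu> E)) f"

definition complex_integral ::
    "('a::topological_space set \<Rightarrow> complex) \<Rightarrow> ('a \<Rightarrow> complex) \<Rightarrow> complex" where
  "complex_integral \<nu> f =
     signed_integral (\<lambda>E. Re (\<nu> E)) f + \<i> * signed_integral (\<lambda>E. Im (\<nu> E)) f"

text \<open>
  \<open>(\<mu> * \<nu>)(E) = \<integral> \<mu>(E t\<^sup>-\<^sup>1) d\<nu>(t) = \<integral>\<integral> 1\<^sub>E(s t) d\<mu>(s) d\<nu>(t)\<close>. The iterated form is needed because,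
  without second countability, multiplication need not be measurable for the product of the
  Borel \<open>\<sigma>\<close>-algebras.
\<close>

definition convolve ::
    "('a::topological_group_add set \<Rightarrow> complex) \<Rightarrow> ('a set \<Rightarrow> complex) \<Rightarrow> ('a set \<Rightarrow> complex)" where
  "convolve \<mu> \<nu> =
     (\<lambda>E. if E \<in> sets borel then complex_integral \<nu> (\<lambda>t. \<mu> {s. s + t \<in> E}) else 0)"

definition cscale :: "complex \<Rightarrow> ('a set \<Rightarrow> complex) \<Rightarrow> ('a set \<Rightarrow> complex)" where
  "cscale c \<mu> = (\<lambda>E. c * \<mu> E)"

lemma vector_space_cscale: "vector_space cscale"
  by unfold_locales (auto simp: cscale_def fun_eq_iff algebra_simps)

definition regular_complex_measures :: "('a::topological_group_add set \<Rightarrow> complex) set" where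
  "regular_complex_measures = {\<mu>. complex_borel_measure \<mu> \<and> regular_measure \<mu>}"

definition M_weighted ::
    "('a::topological_group_add \<Rightarrow> real) \<Rightarrow> ('a set \<Rightarrow> complex) set" where
  "M_weighted \<omega> = {\<mu> \<in> regular_complex_measures. (\<integral>\<^sup>+ t. ennreal (\<omega> t) \<partial>total_variation \<mu>) < \<infinity>}"


section \<open>Left ideals of a complex algebra\<close>

text \<open>
  The algebra has underlying set \<open>A\<close>, a subset of an additive group, scalar multiplication \<open>sc\<close>
  and product \<open>m\<close>.
\<close>

definition left_ideal ::
    "'v::ab_group_add set \<Rightarrow> (complex \<Rightarrow> 'v \<Rightarrow> 'v) \<Rightarrow> ('v \<Rightarrow> 'v \<Rightarrow> 'v) \<Rightarrow> 'v set \<Rightarrow> bool" where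
  "left_ideal A sc m I \<longleftrightarrow>
     I \<subseteq> A \<and> module.subspace sc I \<and> (\<forall>a \<in> A. \<forall>x \<in> I. m a x \<in> I)"

definition maximal_left_ideal ::
    "'v::ab_group_add set \<Rightarrow> (complex \<Rightarrow> 'v \<Rightarrow> 'v) \<Rightarrow> ('v \<Rightarrow> 'v \<Rightarrow> 'v) \<Rightarrow> 'v set \<Rightarrow> bool" where
  "maximal_left_ideal A sc m I \<longleftrightarrow>
     left_ideal A sc m I \<and> I \<noteq> A \<and>
     (\<forall>J. left_ideal A sc m J \<longrightarrow> I \<subseteq> J \<longrightarrow> J = I \<or> J = A)"

definition fin_gen_left_ideal ::
    "'v::ab_group_add set \<Rightarrow> ('v \<Rightarrow> 'v \<Rightarrow> 'v) \<Rightarrow> 'v set \<Rightarrow> bool" where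
  "fin_gen_left_ideal A m I \<longleftrightarrow>
     (\<exists>(n::nat) x. (\<forall>i<n. x i \<in> A) \<and>
        I = {\<Sum>i<n. m (a i) (x i) | a. \<forall>i<n. a i \<in> A})"

definition finite_dimensional ::
    "'v::ab_group_add set \<Rightarrow> (complex \<Rightarrow> 'v \<Rightarrow> 'v) \<Rightarrow> bool" where
  "finite_dimensional A sc \<longleftrightarrow> (\<exists>B. finite B \<and> B \<subseteq> A \<and> module.span sc B = A)"

end

theory Submission
  imports Defs "HOL-Probability.Giry_Monad"
begin

text \<open>
  The theorem holds because its hypothesis fails: for non-discrete \<open>G\<close> the algebra
  \<open>M(G,\<omega>)\<close> has a maximal left ideal that is not finitely generated.

  Write \<open>\<phi>(\<mu>) = \<Sum>\<^sub>t \<mu>({t})\<close> for the mass of the discrete part of \<open>\<mu>\<close>. A complex measure has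
  countably many atoms, so \<open>\<phi>(\<mu>) = \<mu>(D)\<close> for every countable \<open>D\<close> containing them
  (\<open>discrete_mass_eq\<close>). The identity behind the whole argument is
  \<open>(\<mu> * \<nu>)(D) = \<mu>(D) \<nu>(D)\<close> for a countable subgroup \<open>D\<close> containing the atoms of \<open>\<nu>\<close>
  (\<open>convolve_countable_subgroup\<close>). With \<open>D\<close> containing the atoms of \<open>\<mu>\<close> and \<open>\<mu> * \<nu>\<close> as well, it says
  that \<open>\<phi>\<close> is multiplicative, and so \<open>ker \<phi>\<close> is a left ideal of codimension one, hence
  maximal. Suppose that \<open>x\<^sub>1, \<dots>, x\<^sub>n\<close> generate \<open>ker \<phi>\<close> and let \<open>D\<close> be a countable
  subgroup containing all their atoms. Then \<open>(a * x\<^sub>i)(D) = a(D) \<phi>(x\<^sub>i) = 0\<close> for all \<open>a\<close>, so every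
  measure in \<open>ker \<phi>\<close> vanishes on \<open>D\<close>. By Baire's theorem a non-discrete locally compact group is
  uncountable; for \<open>g \<notin> D\<close> the measure \<open>\<delta>\<^sub>0 - \<delta>\<^sub>g\<close> lies in \<open>ker \<phi>\<close> and has value \<open>1\<close> on \<open>D\<close>, a
  contradiction (\<open>not_fin_gen_discrete_mass\<close>).

  Most of the work is to show that \<open>M(G,\<omega>)\<close> is closed under convolution, which is part of
  \<open>ker \<phi>\<close> being a left ideal. The total variation of \<open>\<mu> * \<nu>\<close> is at most four times the positive
  convolution \<open>|\<mu>| * |\<nu>|\<close>, the constant coming from the four Jordan parts of \<open>\<nu>\<close>. Regularity and the
  weighted norm bound pass to dominated measures, so they only have to be proved for
  \<open>|\<mu>| * |\<nu>|\<close>; regularity of the latter (\<open>radon_conv_measure\<close>) rests on the lower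
  semicontinuity of \<open>t \<mapsto> |\<mu>|(U t\<^sup>-\<^sup>1)\<close> for open \<open>U\<close> and on a compactness argument.
\<close>

section \<open>Variations of complex measures\<close>

text \<open>
  Both variations are suprema of sums over pieces of a set. For such set functions finite
  superadditivity and countable subadditivity are the two natural estimates, and together they
  give countable additivity, so that \<open>measure_of\<close> returns a measure with the expected values.
\<close>

lemma emeasure_measure_of_superadditive:
  fixes F :: "'a::topological_space set \<Rightarrow> ennreal"
  assumes empty: "F {} = 0"
    and super: "\<And>A B. A \<in> sets borel \<Longrightarrow> B \<in> sets borel \<Longrightarrow> A \<inter> B = {} \<Longrightarrow> F A + F B \<le> F (A \<union> B)"
    and sub: "\<And>A :: nat \<Rightarrow> 'a set. range A \<subseteq> sets borel \<Longrightarrow> disjoint_family A \<Longrightarrow>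
                F (\<Union>i. A i) \<le> (\<Sum>i. F (A i))"
    and E: "E \<in> sets borel"
  shows "emeasure (measure_of UNIV (sets borel) F) E = F E"
proof -
  have mono: "F A \<le> F B" if "A \<in> sets borel" "B \<in> sets borel" "A \<subseteq> B" for A B
  proof -
    have "F A + F (B - A) \<le> F (A \<union> (B - A))" using that by (intro super) auto
    also have "A \<union> (B - A) = B" using that by auto
    finally show ?thesis by (rule order_trans[rotated]) (simp add: add_increasing2)
  qed
  have "countably_additive (sets borel) F"
  proof (rule countably_additiveI)
    fix A :: "nat \<Rightarrow> 'a set"
    assume A: "range A \<subseteq> sets borel" "disjoint_family A" "\<Union>(range A) \<in> sets borel"
    have fin: "(\<Sum>i<n. F (A i)) \<le> F (\<Union>i<n. A i)" for n
    proof (induction n)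
      case (Suc n)
      have "A n \<inter> A i = {}" if "i < n" for i
        using A(2) that by (simp add: disjoint_family_on_def)
      then have disj: "(\<Union>i<n. A i) \<inter> A n = {}" by blast
      have "(\<Sum>i<Suc n. F (A i)) \<le> F (\<Union>i<n. A i) + F (A n)"
        using Suc by (auto intro: add_right_mono)
      also have "\<dots> \<le> F ((\<Union>i<n. A i) \<union> A n)"
        using A disj by (intro super) auto
      also have "(\<Union>i<n. A i) \<union> A n = (\<Union>i<Suc n. A i)" by (auto simp: less_Suc_eq)
      finally show ?case .
    qed (simp add: empty)
    have "(\<Sum>i. F (A i)) \<le> F (\<Union>i. A i)"
    proof (rule suminf_le_const)
      fix n
      have "F (\<Union>i<n. A i) \<le> F (\<Union>i. A i)"
        using A by (intro mono) auto
      with fin show "(\<Sum>i<n. F (A i)) \<le> F (\<Union>i. A i)" by (rule order_trans)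
    qed simp
    with sub[OF A(1,2)] show "(\<Sum>i. F (A i)) = F (\<Union>i. A i)" by (rule antisym[rotated])
  qed
  moreover have "positive (sets borel) F" by (simp add: positive_def empty)
  ultimately show ?thesis
    using E sets.sigma_algebra_axioms[of "borel :: 'a measure"]
    by (intro emeasure_measure_of_sigma) simp_all
qed

lemma ennreal_plus_le: "ennreal (a + b) \<le> ennreal a + ennreal b"
proof (cases "0 \<le> a \<and> 0 \<le> b")
  case False
  then have "a + b \<le> a \<or> a + b \<le> b" by auto
  then have "ennreal (a + b) \<le> ennreal a \<or> ennreal (a + b) \<le> ennreal b"
    by (auto intro: ennreal_leI)
  then show ?thesis by (auto intro: add_increasing add_increasing2)
qed simp

text \<open>
  Used with the norm and with the identity of the reals as \<open>g\<close>. The right-hand side may be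
  infinite, so there is no need to discuss absolute convergence of the series.
\<close>

lemma sums_ennreal_le_suminf:
  fixes f :: "nat \<Rightarrow> 'b::real_normed_vector" and g :: "'b \<Rightarrow> real"
  assumes "f sums s" "continuous_on UNIV g" "g 0 \<le> 0" "\<And>x y. g (x + y) \<le> g x + g y"
  shows "ennreal (g s) \<le> (\<Sum>i. ennreal (g (f i)))"
proof (rule LIMSEQ_le_const2)
  have "(\<lambda>n. g (\<Sum>i<n. f i)) \<longlonglongrightarrow> g s"
    using assms(1,2) by (intro continuous_on_tendsto_compose[of UNIV g]) (auto simp: sums_def)
  then show "(\<lambda>n. ennreal (g (\<Sum>i<n. f i))) \<longlonglongrightarrow> ennreal (g s)" by (rule tendsto_ennrealI)
  have "ennreal (g (\<Sum>i<n. f i)) \<le> (\<Sum>i<n. ennreal (g (f i)))" for n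
  proof (induction n)
    case 0
    then show ?case using assms(3) by (simp add: ennreal_neg)
  next
    case (Suc n)
    have "ennreal (g (\<Sum>i<Suc n. f i)) \<le> ennreal (g (\<Sum>i<n. f i) + g (f n))"
      using assms(4) by (auto intro: ennreal_leI)
    also have "\<dots> \<le> ennreal (g (\<Sum>i<n. f i)) + ennreal (g (f n))"
      by (rule ennreal_plus_le)
    also have "\<dots> \<le> (\<Sum>i<n. ennreal (g (f i))) + ennreal (g (f n))"
      using Suc by (rule add_right_mono)
    finally show ?case by simp
  qed
  then have "ennreal (g (\<Sum>i<n. f i)) \<le> (\<Sum>i. ennreal (g (f i)))" for n
    by (rule order_trans[OF _ sum_le_suminf]) auto
  then show "\<exists>N. \<forall>n\<ge>N. ennreal (g (\<Sum>i<n. f i)) \<le> (\<Sum>i. ennreal (g (f i)))" by blast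
qed

lemma ennreal_norm_sums_le: "f sums s \<Longrightarrow> ennreal (norm s) \<le> (\<Sum>i. ennreal (norm (f i)))"
  by (rule sums_ennreal_le_suminf[where g=norm]) (simp_all add: continuous_on_norm_id norm_triangle_ineq)

lemma ennreal_sums_le: "f sums s \<Longrightarrow> ennreal (s::real) \<le> (\<Sum>i. ennreal (f i))"
  by (rule sums_ennreal_le_suminf[where g="\<lambda>x. x"]) simp_all

lemma complex_borel_measure_sums:
  assumes "complex_borel_measure \<mu>" "range A \<subseteq> sets borel" "disjoint_family A"
  shows "(\<lambda>i::nat. \<mu> (A i)) sums \<mu> (\<Union>i. A i)"
  using assms by (auto simp: complex_borel_measure_def)

lemma complex_borel_measure_empty:
  assumes "complex_borel_measure \<mu>" shows "\<mu> {} = 0"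
proof -
  have "(\<lambda>i::nat. \<mu> {}) sums \<mu> (\<Union>i::nat. {})"
    using assms by (intro complex_borel_measure_sums) (auto simp: disjoint_family_on_def)
  then have "(\<lambda>i::nat. \<mu> {}) \<longlonglongrightarrow> 0" using sums_summable summable_LIMSEQ_zero by blast
  then show ?thesis by (simp add: LIMSEQ_const_iff)
qed

lemma complex_borel_measure_Un:
  assumes "complex_borel_measure \<mu>" "A \<in> sets borel" "B \<in> sets borel" "A \<inter> B = {}"
  shows "\<mu> (A \<union> B) = \<mu> A + \<mu> B"
proof -
  have "(\<lambda>i. \<mu> (binaryset A B i)) sums \<mu> (\<Union>i. binaryset A B i)"
    using assms by (intro complex_borel_measure_sums)
      (auto simp: disjoint_family_on_def binaryset_def)
  moreover have "(\<lambda>i. \<mu> (binaryset A B i)) sums (\<mu> A + \<mu> B)"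
    using complex_borel_measure_empty[OF assms(1)] by (intro binaryset_sums) 
  ultimately show ?thesis by (simp add: sums_unique2 UN_binaryset_eq)
qed

lemma complex_borel_measure_sums_Int:
  assumes "complex_borel_measure \<mu>" "range A \<subseteq> sets borel" "disjoint_family A"
    "F \<in> sets borel" "F \<subseteq> (\<Union>i. A i)"
  shows "(\<lambda>i::nat. \<mu> (F \<inter> A i)) sums \<mu> F"
proof -
  have "(\<lambda>i::nat. \<mu> (F \<inter> A i)) sums \<mu> (\<Union>i. F \<inter> A i)"
    using assms by (intro complex_borel_measure_sums) (auto simp: disjoint_family_on_def)
  moreover have "(\<Union>i. F \<inter> A i) = F" using assms(5) by auto
  ultimately show ?thesis by simp
qed

definition borel_partitions :: "'a::topological_space set \<Rightarrow> (nat \<Rightarrow> 'a set) set" where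
  "borel_partitions E = {A. range A \<subseteq> sets borel \<and> disjoint_family A \<and> (\<Union>i. A i) = E}"

lemma trivial_partition:
  "E \<in> sets borel \<Longrightarrow> (\<lambda>i. if i = 0 then E else {}) \<in> borel_partitions E"
  by (auto simp: borel_partitions_def disjoint_family_on_def split: if_splits)

lemma restricted_partition:
  assumes "A \<in> borel_partitions E" "B \<in> sets borel" "B \<subseteq> E"
  shows "(\<lambda>i. A i \<inter> B) \<in> borel_partitions B"
proof -
  have A: "range A \<subseteq> sets borel" "disjoint_family A" "(\<Union>i. A i) = E"
    using assms(1) by (simp_all add: borel_partitions_def)
  have "(A m \<inter> B) \<inter> (A n \<inter> B) = {}" if "m \<noteq> n" for m n
    using disjoint_family_onD[OF A(2) UNIV_I UNIV_I that] by blast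
  then have "disjoint_family (\<lambda>i. A i \<inter> B)" by (simp add: disjoint_family_on_def)
  moreover have "range (\<lambda>i. A i \<inter> B) \<subseteq> sets borel" using A(1) assms(2) by auto
  moreover have "(\<Union>i. A i \<inter> B) = B" using A(3) assms(3) by auto
  ultimately show ?thesis by (simp add: borel_partitions_def)
qed

text \<open>
  A partition of \<open>A\<close> on the even indices and one of \<open>B\<close> on the odd indices: superadditivity of
  the total variation, for partitions indexed by the natural numbers.
\<close>

lemma interleaved_partition:
  assumes "P \<in> borel_partitions A" "Q \<in> borel_partitions B" "A \<inter> B = {}"
  shows "(\<lambda>i. if even i then P (i div 2) else Q (i div 2)) \<in> borel_partitions (A \<union> B)"
    (is "?R \<in> _")
proof -
  have P: "range P \<subseteq> sets borel" "disjoint_family P" "(\<Union>i. P i) = A"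
    and Q: "range Q \<subseteq> sets borel" "disjoint_family Q" "(\<Union>i. Q i) = B"
    using assms by (auto simp: borel_partitions_def)
  have "(\<Union>i. ?R i) = A \<union> B"
  proof
    show "(\<Union>i. ?R i) \<subseteq> A \<union> B" using P(3) Q(3) by (auto split: if_splits)
    have "P i \<subseteq> (\<Union>i. ?R i)" for i by (rule order_trans[OF _ UN_upper[of "2*i"]]) auto
    moreover have "Q i \<subseteq> (\<Union>i. ?R i)" for i by (rule order_trans[OF _ UN_upper[of "2*i+1"]]) auto
    ultimately show "A \<union> B \<subseteq> (\<Union>i. ?R i)" unfolding P(3)[symmetric] Q(3)[symmetric] by blast
  qed
  moreover have "disjoint_family ?R"
    unfolding disjoint_family_on_def
  proof safe
    fix m n :: nat and x assume mn: "m \<noteq> n" "x \<in> ?R m" "x \<in> ?R n"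
    have parity: "even m = even n"
      using mn assms(3) P(3) Q(3) by (auto split: if_splits)
    moreover from this mn(1) have "m div 2 \<noteq> n div 2"
      by (metis div_mult_mod_eq parity_cases)
    ultimately have "P (m div 2) \<inter> P (n div 2) = {}" "Q (m div 2) \<inter> Q (n div 2) = {}"
      using P(2) Q(2) by (auto simp: disjoint_family_on_def)
    then show "x \<in> {}"
      using mn parity by (auto split: if_splits)
  qed
  moreover have "range ?R \<subseteq> sets borel" using P(1) Q(1) by auto
  ultimately show ?thesis by (simp add: borel_partitions_def)
qed

text \<open>
  Superadditivity comes from interleaving partitions; for countable subadditivity, a partition
  of the union is cut along the pieces of the union.
\<close>

lemma emeasure_total_variation:
  assumes \<mu>: "complex_borel_measure \<mu>" and E: "E \<in> sets borel"
  shows "emeasure (total_variation \<mu>) E =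
           (SUP A \<in> borel_partitions E. \<Sum>i. ennreal (cmod (\<mu> (A i))))"
proof -
  define V where "V E = (SUP A \<in> borel_partitions E. \<Sum>i. ennreal (cmod (\<mu> (A i))))" for E
  have upper: "(\<Sum>i. ennreal (cmod (\<mu> (A i)))) \<le> V E" if "A \<in> borel_partitions E" for A E
    unfolding V_def using that by (rule SUP_upper)
  have "emeasure (measure_of UNIV (sets borel) V) E = V E"
  proof (rule emeasure_measure_of_superadditive[OF _ _ _ E])
    have "\<mu> (A i) = 0" if "A \<in> borel_partitions {}" for A i
      using that complex_borel_measure_empty[OF \<mu>] by (auto simp: borel_partitions_def)
    then show "V {} = 0"
      unfolding V_def by (intro antisym SUP_least) simp_all
  next
    fix A B :: "'a set" assume AB: "A \<in> sets borel" "B \<in> sets borel" "A \<inter> B = {}"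
    have PQ: "(\<Sum>i. ennreal (cmod (\<mu> (P i)))) + (\<Sum>i. ennreal (cmod (\<mu> (Q i)))) \<le> V (A \<union> B)"
      if PQ: "P \<in> borel_partitions A" "Q \<in> borel_partitions B" for P Q
    proof -
      define R where "R = (\<lambda>i. if even i then P (i div 2) else Q (i div 2))"
      have "(\<Sum>i<n. ennreal (cmod (\<mu> (P i))) + ennreal (cmod (\<mu> (Q i)))) \<le> V (A \<union> B)" for n
      proof -
        have "(\<Sum>i<n. ennreal (cmod (\<mu> (P i))) + ennreal (cmod (\<mu> (Q i)))) =
                (\<Sum>i<2*n. ennreal (cmod (\<mu> (R i))))"
          by (induction n) (simp_all add: R_def ac_simps)
        also have "\<dots> \<le> (\<Sum>i. ennreal (cmod (\<mu> (R i))))"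
          by (rule sum_le_suminf) auto
        also have "\<dots> \<le> V (A \<union> B)"
          unfolding R_def by (intro upper interleaved_partition[OF PQ AB(3)])
        finally show ?thesis .
      qed
      then have "(\<Sum>i. ennreal (cmod (\<mu> (P i))) + ennreal (cmod (\<mu> (Q i)))) \<le> V (A \<union> B)"
        by (intro suminf_le_const) auto
      then show ?thesis by (simp add: suminf_add)
    qed
    have ne: "borel_partitions A \<noteq> {}" "borel_partitions B \<noteq> {}"
      using trivial_partition AB by blast+
    show "V A + V B \<le> V (A \<union> B)"
      unfolding V_def[of A] V_def[of B]
      by (subst ennreal_SUP_add_left[OF ne(1), symmetric], intro SUP_least,
          subst ennreal_SUP_add_right[OF ne(2)], intro SUP_least PQ)
  next
    fix B :: "nat \<Rightarrow> 'a set" assume B: "range B \<subseteq> sets borel" "disjoint_family B"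
    show "V (\<Union>i. B i) \<le> (\<Sum>i. V (B i))"
      unfolding V_def[of "\<Union>i. B i"]
    proof (intro SUP_least suminf_le_const)
      fix A n assume A: "A \<in> borel_partitions (\<Union>i. B i)"
      have "(\<Sum>i<n. ennreal (cmod (\<mu> (A i)))) \<le> (\<Sum>i<n. \<Sum>k. ennreal (cmod (\<mu> (A i \<inter> B k))))"
        using A B by (intro sum_mono ennreal_norm_sums_le complex_borel_measure_sums_Int \<mu>)
          (auto simp: borel_partitions_def)
      also have "\<dots> = (\<Sum>k. \<Sum>i<n. ennreal (cmod (\<mu> (A i \<inter> B k))))"
        by (rule suminf_sum[symmetric]) auto
      also have "\<dots> \<le> (\<Sum>k. V (B k))"
      proof (intro suminf_le)
        fix k
        have "(\<Sum>i<n. ennreal (cmod (\<mu> (A i \<inter> B k)))) \<le> (\<Sum>i. ennreal (cmod (\<mu> (A i \<inter> B k))))"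
          by (rule sum_le_suminf) auto
        also have "\<dots> \<le> V (B k)"
          using A B by (intro upper restricted_partition[OF A]) auto
        finally show "(\<Sum>i<n. ennreal (cmod (\<mu> (A i \<inter> B k)))) \<le> V (B k)" .
      qed auto
      finally show "(\<Sum>i<n. ennreal (cmod (\<mu> (A i)))) \<le> (\<Sum>k. V (B k))" .
    qed simp
  qed
  then show ?thesis
    by (simp add: V_def[abs_def] borel_partitions_def total_variation_def)
qed

lemma sets_total_variation [simp, measurable_cong]: "sets (total_variation \<mu>) = sets (borel :: 'a measure)"
  for \<mu> :: "'a::topological_space set \<Rightarrow> complex"
  unfolding total_variation_def
  by (rule sets.sets_measure_of_eq[of "borel :: 'a measure", unfolded space_borel])

lemma space_total_variation [simp]: "space (total_variation \<mu>) = (UNIV :: 'a set)"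
  for \<mu> :: "'a::topological_space set \<Rightarrow> complex"
  unfolding total_variation_def
  by (rule sets.space_measure_of_eq[of "borel :: 'a measure", unfolded space_borel])

lemma norm_le_total_variation:
  assumes "complex_borel_measure \<mu>"
  shows "ennreal (cmod (\<mu> E)) \<le> emeasure (total_variation \<mu>) E"
proof (cases "E \<in> sets borel")
  case True
  have "ennreal (cmod (\<mu> E)) = (\<Sum>i::nat. ennreal (cmod (\<mu> (if i = 0 then E else {}))))"
    using complex_borel_measure_empty[OF assms]
    by (subst suminf_finite[of "{0}"]) auto
  also have "\<dots> \<le> emeasure (total_variation \<mu>) E"
    unfolding emeasure_total_variation[OF assms True]
    using SUP_upper[OF trivial_partition[OF True], of "\<lambda>A. \<Sum>i. ennreal (cmod (\<mu> (A i)))"]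
    by (simp only: if_distrib)
  finally show ?thesis .
next
  case False
  then have "\<mu> E = 0" using assms unfolding complex_borel_measure_def by blast
  then show ?thesis by simp
qed

lemma total_variation_minimal:
  assumes "complex_borel_measure \<mu>" "E \<in> sets borel"
    and "\<And>A. A \<in> borel_partitions E \<Longrightarrow> (\<Sum>i. ennreal (cmod (\<mu> (A i)))) \<le> c"
  shows "emeasure (total_variation \<mu>) E \<le> c"
  unfolding emeasure_total_variation[OF assms(1,2)] using assms(3) by (rule SUP_least)

section \<open>Jordan decomposition and integration against a complex measure\<close>

lemma sets_positive_variation [simp, measurable_cong]:
  "sets (positive_variation \<nu>) = sets (borel :: 'a measure)"
  for \<nu> :: "'a::topological_space set \<Rightarrow> real"
  unfolding positive_variation_def
  by (rule sets.sets_measure_of_eq[of "borel :: 'a measure", unfolded space_borel])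

lemma space_positive_variation [simp]: "space (positive_variation \<nu>) = (UNIV :: 'a set)"
  for \<nu> :: "'a::topological_space set \<Rightarrow> real"
  unfolding positive_variation_def
  by (rule sets.space_measure_of_eq[of "borel :: 'a measure", unfolded space_borel])

text \<open>
  Stated for \<open>r \<circ> \<mu>\<close> with a bounded real-linear functional \<open>r\<close>, in order to treat the real and
  the imaginary part of \<open>\<mu>\<close> and their negatives at once.
\<close>

lemma emeasure_positive_variation:
  assumes \<mu>: "complex_borel_measure \<mu>" and r: "bounded_linear r" and E: "E \<in> sets borel"
  shows "emeasure (positive_variation (\<lambda>F. r (\<mu> F))) E =
           (SUP F \<in> {F \<in> sets borel. F \<subseteq> E}. ennreal (r (\<mu> F)))"
proof -
  define V where "V E = (SUP F \<in> {F \<in> sets borel. F \<subseteq> E}. ennreal (r (\<mu> F)))" for E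
  have upper: "ennreal (r (\<mu> F)) \<le> V E" if "F \<in> sets borel" "F \<subseteq> E" for F E
    unfolding V_def using that by (intro SUP_upper) simp
  have "emeasure (measure_of UNIV (sets borel) V) E = V E"
  proof (rule emeasure_measure_of_superadditive[OF _ _ _ E])
    have "r (\<mu> {}) = 0"
      using complex_borel_measure_empty[OF \<mu>] linear_0[OF bounded_linear.linear[OF r]] by simp
    then have "ennreal (r (\<mu> F)) \<le> 0" if "F \<subseteq> {}" for F using that by simp
    then have "V {} \<le> 0" unfolding V_def by (intro SUP_least) blast
    then show "V {} = 0" by simp
  next
    fix A B :: "'a set" assume AB: "A \<in> sets borel" "B \<in> sets borel" "A \<inter> B = {}"
    have FG: "ennreal (r (\<mu> F)) + ennreal (r (\<mu> G)) \<le> V (A \<union> B)"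
      if F: "F \<in> {F \<in> sets borel. F \<subseteq> A}" and G: "G \<in> {F \<in> sets borel. F \<subseteq> B}" for F G
    proof -
      have "\<mu> (F \<union> G) = \<mu> F + \<mu> G"
        using F G AB by (intro complex_borel_measure_Un \<mu>) auto
      then have "r (\<mu> (F \<union> G)) = r (\<mu> F) + r (\<mu> G)"
        using linear_add[OF bounded_linear.linear[OF r]] by simp
      then have "ennreal (r (\<mu> F)) + ennreal (r (\<mu> G)) \<le> V (A \<union> B)"
        if "0 \<le> r (\<mu> F)" "0 \<le> r (\<mu> G)"
        using upper[of "F \<union> G" "A \<union> B"] F G that by (auto simp: ennreal_plus)
      moreover have "ennreal (r (\<mu> F)) \<le> V (A \<union> B)" "ennreal (r (\<mu> G)) \<le> V (A \<union> B)"
        using F G by (auto intro!: upper)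
      ultimately show ?thesis
        by (cases "0 \<le> r (\<mu> F)"; cases "0 \<le> r (\<mu> G)") (simp_all add: ennreal_neg)
    qed
    have ne: "{F \<in> sets borel. F \<subseteq> A} \<noteq> {}" "{F \<in> sets borel. F \<subseteq> B} \<noteq> {}" by auto
    show "V A + V B \<le> V (A \<union> B)"
      unfolding V_def[of A] V_def[of B]
      by (subst ennreal_SUP_add_left[OF ne(1), symmetric], intro SUP_least,
          subst ennreal_SUP_add_right[OF ne(2)], intro SUP_least FG)
  next
    fix B :: "nat \<Rightarrow> 'a set" assume B: "range B \<subseteq> sets borel" "disjoint_family B"
    have "ennreal (r (\<mu> F)) \<le> (\<Sum>i. V (B i))" if "F \<in> sets borel" "F \<subseteq> (\<Union>i. B i)" for F
    proof -
      have "(\<lambda>i. r (\<mu> (F \<inter> B i))) sums r (\<mu> F)"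
        using complex_borel_measure_sums_Int[OF \<mu> B that] by (rule bounded_linear.sums[OF r])
      then have "ennreal (r (\<mu> F)) \<le> (\<Sum>i. ennreal (r (\<mu> (F \<inter> B i))))"
        by (rule ennreal_sums_le)
      also have "\<dots> \<le> (\<Sum>i. V (B i))"
        using B that by (intro suminf_le upper) auto
      finally show ?thesis .
    qed
    then show "V (\<Union>i. B i) \<le> (\<Sum>i. V (B i))"
      unfolding V_def[of "\<Union>i. B i"] by (intro SUP_least) blast
  qed
  then show ?thesis
    by (simp add: V_def[abs_def] positive_variation_def)
qed

lemma positive_variation_le_total_variation:
  assumes \<mu>: "complex_borel_measure \<mu>" and r: "bounded_linear r" "\<And>z. r z \<le> cmod z"
  shows "emeasure (positive_variation (\<lambda>F. r (\<mu> F))) E \<le> emeasure (total_variation \<mu>) E"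
proof (cases "E \<in> sets borel")
  case True
  have "ennreal (r (\<mu> F)) \<le> emeasure (total_variation \<mu>) E" if "F \<in> {F \<in> sets borel. F \<subseteq> E}" for F
  proof -
    have "ennreal (r (\<mu> F)) \<le> ennreal (cmod (\<mu> F))" by (intro ennreal_leI r)
    also have "\<dots> \<le> emeasure (total_variation \<mu>) F" by (rule norm_le_total_variation[OF \<mu>])
    also have "\<dots> \<le> emeasure (total_variation \<mu>) E"
      using that True by (intro emeasure_mono) auto
    finally show ?thesis .
  qed
  then show ?thesis
    unfolding emeasure_positive_variation[OF \<mu> r(1) True] by (rule SUP_least)
qed (simp add: emeasure_notin_sets)

text \<open>
  For \<open>F \<subseteq> E\<close> one has \<open>r(\<mu> F) = r(\<mu> E) - r(\<mu>(E - F))\<close>, and \<open>- r(\<mu>(E - F))\<close> is bounded by the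
  negative variation of \<open>E\<close>; take the supremum over \<open>F\<close>. Applying the result to \<open>- r\<close> as well
  gives the Jordan decomposition.
\<close>

lemma positive_variation_minus_le:
  assumes \<mu>: "complex_borel_measure \<mu>" and r: "bounded_linear r" "\<And>z. \<bar>r z\<bar> \<le> cmod z"
    and fin: "emeasure (total_variation \<mu>) UNIV < \<infinity>" and E: "E \<in> sets borel"
  shows "measure (positive_variation (\<lambda>F. r (\<mu> F))) E
           \<le> r (\<mu> E) + measure (positive_variation (\<lambda>F. - r (\<mu> F))) E"
proof -
  let ?P = "positive_variation (\<lambda>F. r (\<mu> F))" and ?N = "positive_variation (\<lambda>F. - r (\<mu> F))"
  have r': "bounded_linear (\<lambda>z. - r z)" using r(1) by (rule bounded_linear_minus)
  have N_fin: "emeasure ?N E \<noteq> \<infinity>"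
  proof -
    have "emeasure ?N E \<le> emeasure (total_variation \<mu>) E"
      by (rule positive_variation_le_total_variation[OF \<mu> r'])
        (use r(2) in \<open>simp add: abs_le_iff\<close>)
    also have "\<dots> \<le> emeasure (total_variation \<mu>) UNIV" using E by (intro emeasure_mono) auto
    finally show ?thesis using fin by auto
  qed
  have le: "r (\<mu> F) \<le> r (\<mu> E) + measure ?N E" if F: "F \<in> sets borel" "F \<subseteq> E" for F
  proof -
    have "ennreal (- r (\<mu> (E - F))) \<le> emeasure ?N E"
      unfolding emeasure_positive_variation[OF \<mu> r' E] using F E by (intro SUP_upper) auto
    also have "\<dots> = ennreal (measure ?N E)" using N_fin by (simp add: emeasure_eq_ennreal_measure)
    finally have "- r (\<mu> (E - F)) \<le> measure ?N E"
      by (simp add: ennreal_le_iff)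
    moreover have "\<mu> (F \<union> (E - F)) = \<mu> F + \<mu> (E - F)"
      using F E by (intro complex_borel_measure_Un \<mu>) auto
    moreover have "F \<union> (E - F) = E" using F by auto
    ultimately show ?thesis
      using linear_add[OF bounded_linear.linear[OF r(1)]] by simp
  qed
  have "emeasure ?P E \<le> ennreal (r (\<mu> E) + measure ?N E)"
    unfolding emeasure_positive_variation[OF \<mu> r(1) E]
    by (intro SUP_least ennreal_leI le) auto
  moreover have "0 \<le> r (\<mu> E) + measure ?N E"
    using le[of "{}"] complex_borel_measure_empty[OF \<mu>] linear_0[OF bounded_linear.linear[OF r(1)]]
    by simp
  ultimately show ?thesis unfolding measure_def by (intro enn2real_leI)
qed

lemma jordan_decomposition:
  assumes \<mu>: "complex_borel_measure \<mu>" and r: "bounded_linear r" "\<And>z. \<bar>r z\<bar> \<le> cmod z"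
    and fin: "emeasure (total_variation \<mu>) UNIV < \<infinity>" and E: "E \<in> sets borel"
  shows "measure (positive_variation (\<lambda>F. r (\<mu> F))) E
           - measure (positive_variation (\<lambda>F. - r (\<mu> F))) E = r (\<mu> E)"
  using positive_variation_minus_le[OF \<mu> r fin E]
    positive_variation_minus_le[OF \<mu> bounded_linear_minus[OF r(1)] _ fin E] r(2)
  by force

text \<open>
  Domination by a combination of two measures covers sums and scalar multiples of complex
  measures as well as their convolution.
\<close>

lemma nn_integral_le_dominated:
  fixes M N1 N2 :: "'a::topological_space measure"
  assumes sets: "sets M = sets borel" "sets N1 = sets borel" "sets N2 = sets borel"
    and dom: "\<And>E. E \<in> sets borel \<Longrightarrow> emeasure M E \<le> c * emeasure N1 E + d * emeasure N2 E"
    and f: "f \<in> borel_measurable borel"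
  shows "(\<integral>\<^sup>+ t. f t \<partial>M) \<le> c * (\<integral>\<^sup>+ t. f t \<partial>N1) + d * (\<integral>\<^sup>+ t. f t \<partial>N2)"
  using f
proof (induction rule: borel_measurable_induct)
  case (cong f g)
  then have "f = g" by auto
  with cong show ?case by simp
next
  case (set A)
  then show ?case using dom sets by simp
next
  case (mult v u)
  note [measurable_cong] = sets and [measurable] = mult
  have "u * (\<integral>\<^sup>+ t. v t \<partial>M) \<le> u * (c * (\<integral>\<^sup>+ t. v t \<partial>N1) + d * (\<integral>\<^sup>+ t. v t \<partial>N2))"
    using mult by (intro mult_left_mono) auto
  then show ?case by (simp add: nn_integral_cmult algebra_simps)
next
  case (add u v)
  note [measurable_cong] = sets and [measurable] = add
  show ?case using add_mono[OF add.IH(2) add.IH(1)] by (simp add: nn_integral_add algebra_simps)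
next
  case (seq U)
  note [measurable_cong] = sets and [measurable] = seq.hyps(1)
  have SUP: "(\<integral>\<^sup>+ t. (SUP i. U i t) \<partial>N) = (SUP i. \<integral>\<^sup>+ t. U i t \<partial>N)" if "sets N = sets borel" for N
    using seq.hyps that by (intro nn_integral_monotone_convergence_SUP) simp_all
  have "(\<integral>\<^sup>+ t. U i t \<partial>M) \<le> c * (SUP i. \<integral>\<^sup>+ t. U i t \<partial>N1) + d * (SUP i. \<integral>\<^sup>+ t. U i t \<partial>N2)" for i
    by (rule order_trans[OF seq.IH]) (intro add_mono mult_left_mono SUP_upper; simp)
  then show ?case
    by (simp add: SUP_apply SUP[OF sets(1)] SUP[OF sets(2)] SUP[OF sets(3)] SUP_le_iff image_comp)
qed

lemma nn_integral_le_of_emeasure_le: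
  fixes M N :: "'a::topological_space measure"
  assumes sets: "sets M = sets borel" "sets N = sets borel"
    and dom: "\<And>E. E \<in> sets borel \<Longrightarrow> emeasure M E \<le> emeasure N E"
    and f: "f \<in> borel_measurable borel"
  shows "(\<integral>\<^sup>+ t. f t \<partial>M) \<le> (\<integral>\<^sup>+ t. f t \<partial>N)"
  using nn_integral_le_dominated[of M N N 1 0 f] assms by simp

lemma complex_integral_eq:
  "complex_integral \<nu> f =
     (integral\<^sup>L (positive_variation (\<lambda>E. Re (\<nu> E))) f
       - integral\<^sup>L (positive_variation (\<lambda>E. - Re (\<nu> E))) f)
     + \<i> * (integral\<^sup>L (positive_variation (\<lambda>E. Im (\<nu> E))) f
       - integral\<^sup>L (positive_variation (\<lambda>E. - Im (\<nu> E))) f)"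
  by (simp add: complex_integral_def signed_integral_def)

text \<open>
  The four Jordan parts of \<open>\<nu>\<close>, indexed so that part \<open>j\<close> enters with the coefficient \<open>\<i>\<^sup>j\<close>: for
  \<open>j = 0, 1, 2, 3\<close> it is the positive variation of \<open>Re \<nu>\<close>, \<open>Im \<nu>\<close>, \<open>- Re \<nu>\<close>, \<open>- Im \<nu>\<close>.
\<close>

definition jordan_part :: "nat \<Rightarrow> ('a::topological_space set \<Rightarrow> complex) \<Rightarrow> 'a measure" where
  "jordan_part j \<nu> = positive_variation (\<lambda>E. Re ((- \<i>) ^ j * \<nu> E))"

lemma sum_jordan_parts:
  fixes g :: "'a::topological_space measure \<Rightarrow> complex"
  shows "(\<Sum>j<4. \<i> ^ j * g (jordan_part j \<nu>)) =
    (g (positive_variation (\<lambda>E. Re (\<nu> E))) - g (positive_variation (\<lambda>E. - Re (\<nu> E))))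
     + \<i> * (g (positive_variation (\<lambda>E. Im (\<nu> E))) - g (positive_variation (\<lambda>E. - Im (\<nu> E))))"
  by (simp add: jordan_part_def eval_nat_numeral lessThan_Suc algebra_simps)

lemma complex_integral_jordan:
  "complex_integral \<nu> f = (\<Sum>j<4. \<i> ^ j * integral\<^sup>L (jordan_part j \<nu>) f)"
  by (subst sum_jordan_parts[where g = "\<lambda>M. integral\<^sup>L M f"]) (rule complex_integral_eq)

lemma sets_jordan_part [simp, measurable_cong]: "sets (jordan_part j \<nu>) = sets borel"
  by (simp add: jordan_part_def)

lemma space_jordan_part [simp]: "space (jordan_part j \<nu>) = UNIV"
  by (simp add: jordan_part_def)

lemma jordan_part_le_total_variation:
  assumes "complex_borel_measure \<mu>"
  shows "emeasure (jordan_part j \<mu>) E \<le> emeasure (total_variation \<mu>) E"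
  unfolding jordan_part_def
proof (rule positive_variation_le_total_variation[OF assms, where r = "\<lambda>z. Re ((- \<i>) ^ j * z)"])
  show "bounded_linear (\<lambda>z. Re ((- \<i>) ^ j * z))"
    by (intro bounded_linear_compose[OF bounded_linear_Re] bounded_linear_mult_right)
  show "Re ((- \<i>) ^ j * z) \<le> cmod z" for z
    using complex_Re_le_cmod[of "(- \<i>) ^ j * z"] by (simp add: norm_mult norm_power)
qed

lemma complex_measure_jordan:
  assumes \<mu>: "complex_borel_measure \<mu>" and fin: "emeasure (total_variation \<mu>) UNIV < \<infinity>"
    and E: "E \<in> sets borel"
  shows "\<mu> E = (\<Sum>j<4. \<i> ^ j * measure (jordan_part j \<mu>) E)"
  using jordan_decomposition[OF \<mu> bounded_linear_Re abs_Re_le_cmod fin E]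
    jordan_decomposition[OF \<mu> bounded_linear_Im abs_Im_le_cmod fin E]
  unfolding sum_jordan_parts[where g = "\<lambda>M. of_real (measure M E)"]
  by (auto simp: complex_eq_iff)

lemma finite_measure_jordan_part:
  assumes "complex_borel_measure \<mu>" "emeasure (total_variation \<mu>) UNIV < \<infinity>"
  shows "finite_measure (jordan_part j \<mu>)"
  using jordan_part_le_total_variation[OF assms(1), of j UNIV] assms(2)
  by (intro finite_measureI) auto

lemma norm_complex_integral_le:
  assumes "complex_borel_measure \<nu>" "f \<in> borel_measurable borel"
  shows "ennreal (cmod (complex_integral \<nu> f)) \<le> 4 * (\<integral>\<^sup>+ t. ennreal (cmod (f t)) \<partial>total_variation \<nu>)"
proof -
  have part: "ennreal (cmod (integral\<^sup>L (jordan_part j \<nu>) f)) \<le>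
      (\<integral>\<^sup>+ t. ennreal (cmod (f t)) \<partial>total_variation \<nu>)" for j
  proof (cases "integrable (jordan_part j \<nu>) f")
    case True
    then have "ennreal (cmod (integral\<^sup>L (jordan_part j \<nu>) f)) \<le>
        (\<integral>\<^sup>+ t. ennreal (cmod (f t)) \<partial>jordan_part j \<nu>)"
      by (rule integral_norm_bound_ennreal)
    also have "\<dots> \<le> (\<integral>\<^sup>+ t. ennreal (cmod (f t)) \<partial>total_variation \<nu>)"
      using assms by (intro nn_integral_le_of_emeasure_le jordan_part_le_total_variation) simp_all
    finally show ?thesis .
  qed (simp add: not_integrable_integral_eq)
  have "cmod (complex_integral \<nu> f) \<le> (\<Sum>j<4. cmod (\<i> ^ j * integral\<^sup>L (jordan_part j \<nu>) f))"
    unfolding complex_integral_jordan by (rule norm_sum)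
  also have "\<dots> = (\<Sum>j<4. cmod (integral\<^sup>L (jordan_part j \<nu>) f))"
    by (simp add: norm_mult norm_power)
  finally have "ennreal (cmod (complex_integral \<nu> f)) \<le>
      (\<Sum>j<4. ennreal (cmod (integral\<^sup>L (jordan_part j \<nu>) f)))"
    by (simp add: sum_ennreal ennreal_leI)
  also have "\<dots> \<le> (\<Sum>j<(4::nat). \<integral>\<^sup>+ t. ennreal (cmod (f t)) \<partial>total_variation \<nu>)"
    by (intro sum_mono part)
  finally show ?thesis by simp
qed

lemma complex_integral_sums:
  assumes \<nu>: "complex_borel_measure \<nu>" "emeasure (total_variation \<nu>) UNIV < \<infinity>"
    and f: "\<And>i. f i \<in> borel_measurable borel" "\<And>i t. cmod (f i t) \<le> B" "F \<in> borel_measurable borel"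
    and sums: "\<And>t. (\<lambda>i. f i t) sums F t" and bound: "\<And>n t. cmod (\<Sum>i<n. f i t) \<le> B"
  shows "(\<lambda>i. complex_integral \<nu> (f i)) sums complex_integral \<nu> F"
  unfolding complex_integral_jordan
proof (intro sums_sum sums_mult)
  fix j
  interpret P: finite_measure "jordan_part j \<nu>" by (rule finite_measure_jordan_part[OF \<nu>])
  note [measurable] = f(1,3)
  have int: "integrable (jordan_part j \<nu>) (f i)" for i
    using f by (intro P.integrable_const_bound[of _ B]) auto
  have "(\<lambda>n. \<integral>t. (\<Sum>i<n. f i t) \<partial>jordan_part j \<nu>) \<longlonglongrightarrow> integral\<^sup>L (jordan_part j \<nu>) F"
    using sums bound
    by (intro integral_dominated_convergence[where w = "\<lambda>_. B"]) (auto simp: sums_def)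
  then show "(\<lambda>i. integral\<^sup>L (jordan_part j \<nu>) (f i)) sums integral\<^sup>L (jordan_part j \<nu>) F"
    by (simp add: sums_def int)
qed

text \<open>
  The two integrals that are computed below have this form: convolution with a point mass, and
  a convolution evaluated at a countable subgroup.
\<close>

lemma complex_integral_indicator:
  assumes \<nu>: "complex_borel_measure \<nu>" "emeasure (total_variation \<nu>) UNIV < \<infinity>"
    and f: "f \<in> borel_measurable borel" and E: "E \<in> sets borel"
    and N: "N \<in> null_sets (total_variation \<nu>)"
    and eq: "\<And>t. t \<notin> N \<Longrightarrow> f t = (if t \<in> E then c else 0)"
  shows "complex_integral \<nu> f = c * \<nu> E"
proof -
  have "integral\<^sup>L (jordan_part j \<nu>) f = c * measure (jordan_part j \<nu>) E" for j
  proof -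
    interpret P: finite_measure "jordan_part j \<nu>" by (rule finite_measure_jordan_part[OF \<nu>])
    have "N \<in> null_sets (jordan_part j \<nu>)"
      using N jordan_part_le_total_variation[OF \<nu>(1), of j N] by (auto simp: null_sets_def)
    moreover have "f t = indicator E t *\<^sub>R c" if "t \<notin> N" for t
      using eq[OF that] by simp
    ultimately have "AE t in jordan_part j \<nu>. f t = indicator E t *\<^sub>R c"
      by (intro AE_I'[of N]) blast+
    then have "integral\<^sup>L (jordan_part j \<nu>) f = (\<integral>t. indicator E t *\<^sub>R c \<partial>jordan_part j \<nu>)"
      using f E by (intro integral_cong_AE) auto
    also have "\<dots> = measure (jordan_part j \<nu>) E *\<^sub>R c"
      using E by (subst integral_scaleR_left) (auto simp: less_top[symmetric])
    finally show ?thesis by (simp add: scaleR_conv_of_real)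
  qed
  then show ?thesis
    unfolding complex_measure_jordan[OF \<nu> E] complex_integral_jordan sum_distrib_left
    by (simp add: algebra_simps)
qed

section \<open>Radon measures\<close>

text \<open>
  Finite Radon measures. Inner regularity is expressed through the measure of \<open>E - K\<close>, a form that
  passes to dominated measures; for finite measures it implies outer regularity as well.
\<close>

definition radon :: "'a::t2_space measure \<Rightarrow> bool" where
  "radon M \<longleftrightarrow> sets M = sets borel \<and> emeasure M UNIV < \<infinity> \<and>
     (\<forall>E \<in> sets borel. \<forall>\<epsilon>::real > 0. \<exists>K. compact K \<and> K \<subseteq> E \<and> emeasure M (E - K) \<le> ennreal \<epsilon>)"

lemma radon_sets: "radon M \<Longrightarrow> sets M = sets borel"
  and radon_finite: "radon M \<Longrightarrow> emeasure M UNIV < \<infinity>"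
  by (simp_all add: radon_def)

lemma radonD:
  assumes "radon M" "E \<in> sets borel" "0 < (\<epsilon>::real)"
  obtains K where "compact K" "K \<subseteq> E" "emeasure M (E - K) \<le> ennreal \<epsilon>"
  using assms unfolding radon_def by blast

lemma radon_finite_measure: "radon M \<Longrightarrow> finite_measure M"
  using sets_eq_imp_space_eq[of M borel] by (auto simp: radon_def intro!: finite_measureI)

lemma compact_borel [simp]: "compact K \<Longrightarrow> K \<in> sets borel" for K :: "'a::t2_space set"
  by (intro borel_closed compact_imp_closed)

text \<open>
  Inner approximation with an error measured by \<open>E - K\<close> passes to dominated measures by
  taking the union of the two compact sets.
\<close>

lemma radon_dominated:
  fixes M N1 N2 :: "'a::t2_space measure" and c d :: real
  assumes N: "radon N1" "radon N2" and M: "sets M = sets borel" and cd: "0 \<le> c" "0 \<le> d"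
    and dom: "\<And>E. E \<in> sets borel \<Longrightarrow> emeasure M E \<le> ennreal c * emeasure N1 E + ennreal d * emeasure N2 E"
  shows "radon M"
  unfolding radon_def
proof (intro conjI M ballI allI impI)
  have "ennreal c * emeasure N1 UNIV + ennreal d * emeasure N2 UNIV < \<infinity>"
    using N[THEN radon_finite] by (simp add: ennreal_mult_less_top)
  then show "emeasure M UNIV < \<infinity>" using dom[of UNIV] by (auto intro: le_less_trans)
next
  fix E :: "'a set" and \<epsilon> :: real assume E: "E \<in> sets borel" and \<epsilon>: "0 < \<epsilon>"
  \<comment> \<open>the summand \<open>1\<close> keeps the denominator positive when \<open>c = d = 0\<close>\<close>
  define \<delta> where "\<delta> = \<epsilon> / (c + d + 1)"
  have \<delta>: "0 < \<delta>" using \<epsilon> cd by (simp add: \<delta>_def)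
  obtain K where K: "compact K" "K \<subseteq> E" "emeasure N1 (E - K) \<le> ennreal \<delta>"
    using N(1) E \<delta> by (rule radonD)
  obtain L where L: "compact L" "L \<subseteq> E" "emeasure N2 (E - L) \<le> ennreal \<delta>"
    using N(2) E \<delta> by (rule radonD)
  have "emeasure N1 (E - (K \<union> L)) \<le> ennreal \<delta>"
    by (rule order_trans[OF emeasure_mono K(3)]) (use E K L radon_sets[OF N(1)] in auto)
  moreover have "emeasure N2 (E - (K \<union> L)) \<le> ennreal \<delta>"
    by (rule order_trans[OF emeasure_mono L(3)]) (use E K L radon_sets[OF N(2)] in auto)
  ultimately have "emeasure M (E - (K \<union> L)) \<le> ennreal c * ennreal \<delta> + ennreal d * ennreal \<delta>"
    using E K(1) L(1) by (intro order_trans[OF dom] add_mono mult_left_mono) (auto simp: compact_Un)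
  also have "\<dots> = ennreal ((c + d) * \<delta>)"
    using cd \<delta> by (simp add: distrib_right ennreal_plus ennreal_mult less_imp_le)
  also have "\<dots> \<le> ennreal \<epsilon>"
    using cd \<epsilon> by (intro ennreal_leI) (simp add: \<delta>_def field_simps)
  finally show "\<exists>K. compact K \<and> K \<subseteq> E \<and> emeasure M (E - K) \<le> ennreal \<epsilon>"
    using K L by (intro exI[of _ "K \<union> L"]) (auto simp: compact_Un)
qed

lemma radon_le:
  fixes M N :: "'a::t2_space measure"
  assumes "radon N" "sets M = sets borel" "\<And>E. E \<in> sets borel \<Longrightarrow> emeasure M E \<le> emeasure N E"
  shows "radon M"
  using radon_dominated[of N N M 1 0] assms by simp

lemma radon_inner:
  assumes "radon M" and E: "E \<in> sets borel"
  shows "emeasure M E = (SUP K \<in> {K. compact K \<and> K \<in> sets borel \<and> K \<subseteq> E}. emeasure M K)"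
    (is "_ = ?S")
proof (rule antisym)
  show "?S \<le> emeasure M E"
    using radon_sets[OF assms(1)] E by (intro SUP_least emeasure_mono) auto
  show "emeasure M E \<le> ?S"
  proof (rule ennreal_le_epsilon)
    fix \<epsilon> :: real assume "0 < \<epsilon>"
    with assms obtain K where K: "compact K" "K \<subseteq> E" "emeasure M (E - K) \<le> ennreal \<epsilon>"
      by (rule radonD)
    have "emeasure M K + emeasure M (E - K) = emeasure M (K \<union> (E - K))"
      using K E radon_sets[OF assms(1)] by (intro plus_emeasure) auto
    also have "K \<union> (E - K) = E" using K by auto
    finally have "emeasure M E = emeasure M K + emeasure M (E - K)" ..
    also have "\<dots> \<le> ?S + ennreal \<epsilon>"
      using K(1,2) by (intro add_mono SUP_upper K(3)) simp
    finally show "emeasure M E \<le> ?S + ennreal \<epsilon>" .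
  qed
qed

lemma radon_outer:
  assumes "radon M" and E: "E \<in> sets borel"
  shows "emeasure M E = (INF U \<in> {U. open U \<and> E \<subseteq> U}. emeasure M U)"
    (is "_ = ?S")
proof (rule antisym)
  have [measurable_cong]: "sets M = sets borel" using radon_sets[OF assms(1)] .
  show "emeasure M E \<le> ?S"
    by (intro INF_greatest emeasure_mono) auto
  show "?S \<le> emeasure M E"
  proof (rule ennreal_le_epsilon)
    fix \<epsilon> :: real assume \<epsilon>: "0 < \<epsilon>"
    obtain K where K: "compact K" "K \<subseteq> - E" "emeasure M (- E - K) \<le> ennreal \<epsilon>"
      by (rule radonD[OF assms(1) _ \<epsilon>, of "- E"]) (use E in auto)
    have "?S \<le> emeasure M (- K)"
      using K(2) compact_imp_closed[OF K(1)] by (intro INF_lower) auto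
    also have "\<dots> = emeasure M (E \<union> (- E - K))"
      using K by (intro arg_cong[where f="emeasure M"]) auto
    also have "\<dots> \<le> emeasure M E + emeasure M (- E - K)"
      using E K \<open>sets M = sets borel\<close> by (intro emeasure_subadditive) auto
    also have "\<dots> \<le> emeasure M E + ennreal \<epsilon>"
      using K by (intro add_left_mono)
    finally show "?S \<le> emeasure M E + ennreal \<epsilon>" .
  qed
qed

lemma regular_measure_iff_radon:
  assumes fin: "emeasure (total_variation \<mu>) UNIV < \<infinity>"
  shows "regular_measure \<mu> \<longleftrightarrow> radon (total_variation \<mu>)"
proof
  assume reg: "regular_measure \<mu>"
  show "radon (total_variation \<mu>)"
    unfolding radon_def
  proof (intro conjI ballI allI impI fin sets_total_variation)
    fix E :: "'a set" and \<epsilon> :: real assume E: "E \<in> sets borel" and \<epsilon>: "0 < \<epsilon>"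
    let ?M = "total_variation \<mu>"
    have E_fin: "emeasure ?M E < top"
      using emeasure_mono[of E UNIV ?M] fin by (auto intro: le_less_trans)
    have sup: "emeasure ?M E = (SUP K \<in> {K. compact K \<and> K \<in> sets borel \<and> K \<subseteq> E}. emeasure ?M K)"
      using reg E unfolding regular_measure_def by blast
    have "{K. compact K \<and> K \<in> sets borel \<and> K \<subseteq> E} \<noteq> {}"
      by (intro ex_in_conv[THEN iffD1] exI[of _ "{}"]) simp
    then have "\<exists>K\<in>{K. compact K \<and> K \<in> sets borel \<and> K \<subseteq> E}. emeasure ?M E < emeasure ?M K + ennreal \<epsilon>"
      by (rule SUP_approx_ennreal[OF \<epsilon> _ sup]) (use E_fin in simp)
    then obtain K where K: "compact K" "K \<subseteq> E" "emeasure ?M E < emeasure ?M K + ennreal \<epsilon>" by auto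
    have "emeasure ?M (E - K) = emeasure ?M E - emeasure ?M K"
      using K E E_fin emeasure_mono[of K E ?M] by (intro emeasure_Diff) (auto simp: top_unique)
    also have "\<dots> \<le> ennreal \<epsilon>"
      using K(3) E_fin by (auto simp: ennreal_minus_le_iff)
    finally show "\<exists>K. compact K \<and> K \<subseteq> E \<and> emeasure ?M (E - K) \<le> ennreal \<epsilon>"
      using K by blast
  qed
next
  assume "radon (total_variation \<mu>)"
  then show "regular_measure \<mu>"
    unfolding regular_measure_def by (intro ballI conjI radon_outer radon_inner)
qed

text \<open>
  The sets squeezed between a closed and an open set of almost the same measure form a
  \<open>\<sigma>\<close>-algebra, which contains the open sets by assumption. The hypothesis for the whole space gives
  tightness, which turns closed sets into compact ones.
\<close>

lemma radon_of_inner_on_open: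
  fixes M :: "'a::t2_space measure"
  assumes sets_M: "sets M = sets borel" and fin: "emeasure M UNIV < \<infinity>"
    and inner: "\<And>U \<epsilon>. open U \<Longrightarrow> 0 < (\<epsilon>::real) \<Longrightarrow> \<exists>K. compact K \<and> K \<subseteq> U \<and> emeasure M (U - K) \<le> ennreal \<epsilon>"
  shows "radon M"
proof -
  note [measurable_cong] = sets_M
  have space_M: "space M = UNIV" using sets_eq_imp_space_eq[OF sets_M] by simp
  interpret finite_measure M using fin space_M by (intro finite_measureI) auto
  have approx: "\<exists>F U. closed F \<and> open U \<and> F \<subseteq> E \<and> E \<subseteq> U \<and> measure M (U - F) < \<epsilon>"
    if "E \<in> sigma_sets UNIV {U. open U}" "0 < \<epsilon>" for E \<epsilon>
    using that
  proof (induction arbitrary: \<epsilon> rule: sigma_sets.induct)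
    case (Basic U)
    then obtain K where K: "compact K" "K \<subseteq> U" "emeasure M (U - K) \<le> ennreal (\<epsilon> / 2)"
      using inner[of U "\<epsilon> / 2"] by auto
    then have "measure M (U - K) \<le> \<epsilon> / 2"
      using Basic by (simp add: emeasure_eq_measure ennreal_le_iff)
    with Basic K show ?case by (intro exI[of _ K] exI[of _ U]) (auto intro: compact_imp_closed)
  next
    case Empty
    then show ?case by (intro exI[of _ "{}"]) auto
  next
    case (Compl E)
    from Compl.IH[OF Compl.prems] obtain F U where
      "closed F" "open U" "F \<subseteq> E" "E \<subseteq> U" "measure M (U - F) < \<epsilon>" by blast
    moreover have "- F - - U = U - F" by auto
    ultimately show ?case
      by (intro exI[of _ "- U"] exI[of _ "- F"]) auto
  next
    case (Union E)
    have pos: "0 < \<epsilon> / 2 * (1 / 2) ^ Suc n" for n using Union.prems by simp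
    have "\<forall>n. \<exists>F U. closed F \<and> open U \<and> F \<subseteq> E n \<and> E n \<subseteq> U \<and> measure M (U - F) < \<epsilon> / 2 * (1 / 2) ^ Suc n"
      using Union.IH[OF pos] by blast
    then obtain F U where FU: "\<And>n. closed (F n)" "\<And>n. open (U n)" "\<And>n. F n \<subseteq> E n"
      "\<And>n. E n \<subseteq> U n" "\<And>n. measure M (U n - F n) < \<epsilon> / 2 * (1 / 2) ^ Suc n"
      by metis
    have [measurable]: "F n \<in> sets borel" "U n \<in> sets borel" for n using FU(1,2) by auto
    have sums: "(\<lambda>n. \<epsilon> / 2 * (1 / 2) ^ Suc n) sums (\<epsilon> / 2 * 1)"
      by (intro sums_mult power_half_series)
    have summ: "summable (\<lambda>n. measure M (U n - F n))"
      by (rule summable_comparison_test'[OF sums_summable[OF sums]])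
        (use FU(5) in \<open>auto intro: less_imp_le\<close>)
    have "measure M ((\<Union>n. U n) - (\<Union>n. F n)) \<le> measure M (\<Union>n. U n - F n)"
      by (intro finite_measure_mono) auto
    also have "\<dots> \<le> (\<Sum>n. measure M (U n - F n))"
      using summ by (intro finite_measure_subadditive_countably) auto
    also have "\<dots> \<le> (\<Sum>n. \<epsilon> / 2 * (1 / 2) ^ Suc n)"
      using FU(5) by (intro suminf_le summ sums_summable[OF sums]) (auto intro: less_imp_le)
    also have "\<dots> = \<epsilon> / 2" using sums_unique[OF sums] by simp
    finally have half: "measure M ((\<Union>n. U n) - (\<Union>n. F n)) \<le> \<epsilon> / 2" .
    have "(\<lambda>N. measure M ((\<Union>n. U n) - (\<Union>n<N. F n))) \<longlonglongrightarrow> measure M (\<Inter>N. (\<Union>n. U n) - (\<Union>n<N. F n))"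
      by (intro finite_Lim_measure_decseq) (auto simp: decseq_def)
    also have "(\<Inter>N. (\<Union>n. U n) - (\<Union>n<N. F n)) = (\<Union>n. U n) - (\<Union>n. F n)" by auto
    finally have "\<forall>\<^sub>F N in sequentially. measure M ((\<Union>n. U n) - (\<Union>n<N. F n)) < \<epsilon>"
      by (rule order_tendstoD(2)) (use half Union.prems in simp)
    then obtain N where "measure M ((\<Union>n. U n) - (\<Union>n<N. F n)) < \<epsilon>"
      by (auto simp: eventually_sequentially)
    moreover have "closed (\<Union>n<N. F n)" "open (\<Union>n. U n)" using FU by auto
    moreover have "(\<Union>n<N. F n) \<subseteq> (\<Union>n. E n)" "(\<Union>n. E n) \<subseteq> (\<Union>n. U n)" using FU(3,4) by blast+
    ultimately show ?case by blast
  qed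
  show ?thesis
    unfolding radon_def
  proof (intro conjI sets_M fin ballI allI impI)
    fix E :: "'a set" and \<epsilon> :: real assume E: "E \<in> sets borel" and \<epsilon>: "0 < \<epsilon>"
    obtain K where K: "compact K" "emeasure M (UNIV - K) \<le> ennreal (\<epsilon> / 2)"
      using inner[of UNIV "\<epsilon> / 2"] \<epsilon> by auto
    have "E \<in> sigma_sets UNIV {U. open U}" using E by (simp add: borel_def)
    from approx[OF this, of "\<epsilon> / 2"] \<epsilon> obtain F U where
      F: "closed F" "open U" "F \<subseteq> E" "E \<subseteq> U" "measure M (U - F) < \<epsilon> / 2" by auto
    have [measurable]: "F \<in> sets borel" "U \<in> sets borel" "K \<in> sets borel" using F K by auto
    have "emeasure M (E - (F \<inter> K)) \<le> emeasure M ((U - F) \<union> (UNIV - K))"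
      using F by (intro emeasure_mono) auto
    also have "\<dots> \<le> emeasure M (U - F) + emeasure M (UNIV - K)"
      by (intro emeasure_subadditive) measurable
    also have "\<dots> \<le> ennreal (\<epsilon> / 2) + ennreal (\<epsilon> / 2)"
      using F(5) K(2) by (intro add_mono) (auto simp: emeasure_eq_measure intro!: ennreal_leI)
    also have "\<dots> = ennreal \<epsilon>" using \<epsilon> by (simp flip: ennreal_plus)
    finally show "\<exists>K. compact K \<and> K \<subseteq> E \<and> emeasure M (E - K) \<le> ennreal \<epsilon>"
      using F K by (intro exI[of _ "F \<inter> K"]) (auto intro: closed_Int_compact)
  qed
qed

section \<open>Convolution of positive Radon measures\<close>

text \<open>
  The convolution of positive measures, as an iterated integral for the reason given for
  \<open>convolve\<close>.
\<close>

definition conv_measure :: "'a::topological_group_add measure \<Rightarrow> 'a measure \<Rightarrow> 'a measure" where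
  "conv_measure M N = measure_of UNIV (sets borel) (\<lambda>E. \<integral>\<^sup>+ t. emeasure M {s. s + t \<in> E} \<partial>N)"

lemma continuous_right_translation: "continuous_on UNIV (\<lambda>s. s + t)"
  for t :: "'a::topological_group_add"
  by (intro continuous_intros)

lemma measurable_right_translation [measurable]: "(\<lambda>s. s + t) \<in> borel \<rightarrow>\<^sub>M borel"
  for t :: "'a::topological_group_add"
  by (intro borel_measurable_continuous_onI continuous_right_translation)

lemma translate_borel: "E \<in> sets borel \<Longrightarrow> {s. s + t \<in> E} \<in> sets borel"
  for t :: "'a::topological_group_add"
  using measurable_sets[OF measurable_right_translation, of E t] by (simp add: vimage_def)

lemma open_translate: "open U \<Longrightarrow> open {s. s + t \<in> U}"
  for t :: "'a::topological_group_add"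
  using open_vimage[OF _ continuous_right_translation, of U t] by (simp add: vimage_def)

lemma continuous_group_add: "continuous_on UNIV (\<lambda>(s :: 'a::topological_group_add, t). s + t)"
  unfolding case_prod_unfold by (intro continuous_intros)

text \<open>
  The tube lemma for multiplication.
\<close>

lemma open_compact_translates:
  fixes L U :: "'a::topological_group_add set"
  assumes L: "compact L" and U: "open U" and t: "\<And>s. s \<in> L \<Longrightarrow> s + t \<in> U"
  obtains W where "open W" "t \<in> W" "\<forall>s\<in>L. \<forall>t'\<in>W. s + t' \<in> U"
proof -
  have "open ((\<lambda>p::'a \<times> 'a. snd p + fst p) -` U)"
    by (intro open_vimage U continuous_intros)
  moreover have "{t} \<times> L \<subseteq> (\<lambda>p. snd p + fst p) -` U" using t by auto
  ultimately obtain W where "t \<in> W" "open W" "W \<times> L \<subseteq> (\<lambda>p. snd p + fst p) -` U"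
    using Elementary_Topology.tube_lemma[OF L, of "(\<lambda>p. snd p + fst p) -` U" t] by blast
  then show thesis by (intro that[of W]) auto
qed

lemma radon_less_compact:
  assumes M: "radon M" and E: "E \<in> sets borel" and c: "c < emeasure M E"
  obtains K where "compact K" "K \<subseteq> E" "c < emeasure M K"
  using c unfolding radon_inner[OF M E] less_SUP_iff by blast

text \<open>
  Lower semicontinuity of \<open>t \<mapsto> M(U t\<^sup>-\<^sup>1)\<close>: a compact \<open>L \<subseteq> U t\<^sup>-\<^sup>1\<close> of measure
  above \<open>c\<close> stays inside \<open>U t'\<^sup>-\<^sup>1\<close> for \<open>t'\<close> near \<open>t\<close>.
\<close>

lemma open_emeasure_translate_gt:
  fixes M :: "'a::{topological_group_add, t2_space} measure"
  assumes M: "radon M" and U: "open U"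
  shows "open {t. c < emeasure M {s. s + t \<in> U}}"
  unfolding open_subopen[of "{t. c < emeasure M {s. s + t \<in> U}}"]
proof safe
  fix t assume "c < emeasure M {s. s + t \<in> U}"
  then obtain L where L: "compact L" "L \<subseteq> {s. s + t \<in> U}" "c < emeasure M L"
    using radon_less_compact[OF M, of "{s. s + t \<in> U}"] U by (metis borel_open open_translate)
  obtain W where W: "open W" "t \<in> W" "\<forall>s\<in>L. \<forall>t'\<in>W. s + t' \<in> U"
    by (rule open_compact_translates[OF L(1) U subsetD[OF L(2), unfolded mem_Collect_eq]])
  have "c < emeasure M {s. s + t' \<in> U}" if "t' \<in> W" for t'
    using L(3) by (rule less_le_trans)
      (use W(3) that U in \<open>auto intro!: emeasure_mono simp: radon_sets[OF M] open_translate borel_open\<close>)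
  then show "\<exists>T. open T \<and> t \<in> T \<and> T \<subseteq> {t. c < emeasure M {s. s + t \<in> U}}"
    using W(1,2) by blast
qed

text \<open>
  Open sets are covered by lower semicontinuity, and the Borel sets follow by Dynkin's
  \<open>\<pi>\<close>-\<open>\<lambda>\<close> argument, which avoids product \<open>\<sigma>\<close>-algebras.
\<close>

lemma measurable_emeasure_translate:
  fixes M :: "'a::{topological_group_add, t2_space} measure"
  assumes M: "radon M" and E: "E \<in> sets borel"
  shows "(\<lambda>t. emeasure M {s. s + t \<in> E}) \<in> borel_measurable borel"
proof -
  interpret finite_measure M using M by (rule radon_finite_measure)
  have Msets: "sets M = sets borel" using M by (rule radon_sets)
  then have space: "space M = UNIV" by (simp add: sets_eq_imp_space_eq[of M borel])
  have "Int_stable {U :: 'a set. open U}" "{U :: 'a set. open U} \<subseteq> Pow UNIV"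
    "E \<in> sigma_sets UNIV {U. open U}"
    using E by (simp_all add: borel_def Int_stable_def open_Int)
  then show ?thesis
  proof (induction rule: sigma_sets_induct_disjoint)
    case (basic U)
    have "{t. c < emeasure M {s. s + t \<in> U}} \<in> sets borel" for c
      using open_emeasure_translate_gt[OF M, of U c] basic by simp
    then show ?case by (intro borel_measurableI_greater) simp
  next
    case empty
    show ?case by simp
  next
    case (compl E)
    then have E: "E \<in> sets borel" by (simp add: borel_def)
    have "emeasure M {s. s + t \<in> UNIV - E} = emeasure M UNIV - emeasure M {s. s + t \<in> E}" for t
    proof -
      have "{s. s + t \<in> UNIV - E} = space M - {s. s + t \<in> E}" using space by auto
      moreover have "emeasure M (space M - {s. s + t \<in> E}) = emeasure M (space M) - emeasure M {s. s + t \<in> E}"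
        using translate_borel[OF E, of t] Msets by (intro emeasure_compl) simp_all
      ultimately show ?thesis using space by simp
    qed
    then show ?case using compl by simp
  next
    case (union A)
    then have A: "range A \<subseteq> sets borel" by (simp add: borel_def)
    have "emeasure M {s. s + t \<in> (\<Union>i. A i)} = (\<Sum>i. emeasure M {s. s + t \<in> A i})" for t
    proof -
      have "disjoint_family (\<lambda>i. {s. s + t \<in> A i})"
        using union.hyps(1) by (auto simp: disjoint_family_on_def)
      then have "(\<Sum>i. emeasure M {s. s + t \<in> A i}) = emeasure M (\<Union>i. {s. s + t \<in> A i})"
        using A translate_borel Msets by (intro suminf_emeasure) auto
      also have "(\<Union>i. {s. s + t \<in> A i}) = {s. s + t \<in> (\<Union>i. A i)}" by auto
      finally show ?thesis ..
    qed
    then show ?case using union.IH by simp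
  qed
qed

lemma sets_conv_measure [simp, measurable_cong]: "sets (conv_measure M N) = sets borel"
  for M :: "'a::topological_group_add measure"
  unfolding conv_measure_def
  by (rule sets.sets_measure_of_eq[of "borel :: 'a measure", unfolded space_borel])

lemma space_conv_measure [simp]: "space (conv_measure M N) = UNIV"
  for M :: "'a::topological_group_add measure"
  unfolding conv_measure_def
  by (rule sets.space_measure_of_eq[of "borel :: 'a measure", unfolded space_borel])

lemma emeasure_conv_measure:
  fixes M N :: "'a::{topological_group_add, t2_space} measure"
  assumes M: "radon M" and N: "sets N = sets borel" and E: "E \<in> sets borel"
  shows "emeasure (conv_measure M N) E = (\<integral>\<^sup>+ t. emeasure M {s. s + t \<in> E} \<partial>N)"
  unfolding conv_measure_def
proof (rule emeasure_measure_of_sigma[OF _ _ _ E])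
  show "sigma_algebra (UNIV :: 'a set) (sets borel)"
    using sets.sigma_algebra_axioms[of "borel :: 'a measure"] by simp
  show "positive (sets borel) (\<lambda>E. \<integral>\<^sup>+ t. emeasure M {s. s + t \<in> E} \<partial>N)"
    by (simp add: positive_def)
  show "countably_additive (sets borel) (\<lambda>E. \<integral>\<^sup>+ t. emeasure M {s. s + t \<in> E} \<partial>N)"
  proof (rule countably_additiveI)
    fix A :: "nat \<Rightarrow> 'a set"
    assume A: "range A \<subseteq> sets borel" "disjoint_family A"
    have [measurable]: "(\<lambda>t. emeasure M {s. s + t \<in> A i}) \<in> borel_measurable N" for i
      using measurable_emeasure_translate[OF M, of "A i"] A(1) measurable_cong_sets[OF N refl] by blast
    have eq: "(\<Sum>i. emeasure M {s. s + t \<in> A i}) = emeasure M {s. s + t \<in> (\<Union>i. A i)}" for t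
    proof -
      have "disjoint_family (\<lambda>i. {s. s + t \<in> A i})"
        using A(2) by (auto simp: disjoint_family_on_def)
      then have "(\<Sum>i. emeasure M {s. s + t \<in> A i}) = emeasure M (\<Union>i. {s. s + t \<in> A i})"
        using A translate_borel radon_sets[OF M] by (intro suminf_emeasure) auto
      also have "(\<Union>i. {s. s + t \<in> A i}) = {s. s + t \<in> (\<Union>i. A i)}" by auto
      finally show ?thesis .
    qed
    have "(\<Sum>i. \<integral>\<^sup>+ t. emeasure M {s. s + t \<in> A i} \<partial>N) =
            (\<integral>\<^sup>+ t. (\<Sum>i. emeasure M {s. s + t \<in> A i}) \<partial>N)"
      by (rule nn_integral_suminf[symmetric]) simp
    then show "(\<Sum>i. \<integral>\<^sup>+ t. emeasure M {s. s + t \<in> A i} \<partial>N) =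
      (\<integral>\<^sup>+ t. emeasure M {s. s + t \<in> (\<Union>i. A i)} \<partial>N)"
      by (simp only: eq)
  qed
qed

text \<open>
  Measurability of the inner integral is proved in the same induction, since the
  induction step for the outer integral depends on it.
\<close>

lemma nn_integral_conv_measure:
  fixes M N :: "'a::{topological_group_add, t2_space} measure"
  assumes M: "radon M" and N: "sets N = sets borel" and f: "f \<in> borel_measurable borel"
  shows "(\<lambda>t. \<integral>\<^sup>+ s. f (s + t) \<partial>M) \<in> borel_measurable borel \<and>
         (\<integral>\<^sup>+ u. f u \<partial>conv_measure M N) = (\<integral>\<^sup>+ t. \<integral>\<^sup>+ s. f (s + t) \<partial>M \<partial>N)"
  using f
proof (induction rule: borel_measurable_induct)
  case (cong f g)
  then have "f = g" by auto
  with cong show ?case by simp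
next
  case (set A)
  have "(\<integral>\<^sup>+ s. indicator A (s + t) \<partial>M) = emeasure M {s. s + t \<in> A}" for t
  proof -
    have "(\<integral>\<^sup>+ s. indicator A (s + t) \<partial>M) = (\<integral>\<^sup>+ s. indicator {s. s + t \<in> A} s \<partial>M)"
      by (intro nn_integral_cong) (simp add: indicator_def)
    then show ?thesis using translate_borel[OF set, of t] radon_sets[OF M] by simp
  qed
  with set show ?case
    using measurable_emeasure_translate[OF M set] emeasure_conv_measure[OF M N set] by simp
next
  case (mult u v)
  note [measurable_cong] = N radon_sets[OF M] and [measurable] = mult.hyps mult.IH[THEN conjunct1]
  show ?case using mult.IH by (simp add: nn_integral_cmult)
next
  case (add u v)
  note [measurable_cong] = N radon_sets[OF M]
    and [measurable] = add.hyps(1,3) add.IH[THEN conjunct1]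
  show ?case using add.IH by (simp add: nn_integral_add)
next
  case (seq U)
  note [measurable_cong] = N radon_sets[OF M]
    and [measurable] = seq.hyps(1) seq.IH[THEN conjunct1]
  have inc: "incseq (\<lambda>i s. U i (s + t))" "incseq (\<lambda>i. \<integral>\<^sup>+ s. U i (s + t) \<partial>M)" for t
    using seq.hyps by (auto simp: incseq_def le_fun_def intro!: nn_integral_mono)
  have inner: "(\<integral>\<^sup>+ s. (SUP i. U i (s + t)) \<partial>M) = (SUP i. \<integral>\<^sup>+ s. U i (s + t) \<partial>M)" for t
    using inc by (intro nn_integral_monotone_convergence_SUP) simp_all
  have "(\<integral>\<^sup>+ t. (SUP i. \<integral>\<^sup>+ s. U i (s + t) \<partial>M) \<partial>N) = (SUP i. \<integral>\<^sup>+ t. \<integral>\<^sup>+ s. U i (s + t) \<partial>M \<partial>N)"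
    using inc(2) by (intro nn_integral_monotone_convergence_SUP) (simp_all add: incseq_def le_fun_def)
  moreover have "(\<integral>\<^sup>+ u. (SUP i. U i u) \<partial>conv_measure M N) = (SUP i. \<integral>\<^sup>+ u. U i u \<partial>conv_measure M N)"
    using seq.hyps by (intro nn_integral_monotone_convergence_SUP) simp_all
  ultimately show ?case
    using seq.IH by (simp add: SUP_apply inner image_comp)
qed

lemma euclidean_Hausdorff: "Hausdorff_space (euclidean :: 'a::t2_space topology)"
  unfolding Hausdorff_space_def disjnt_def by simp (metis hausdorff)

text \<open>
  A single compact \<open>K \<subseteq> U\<close> can replace \<open>U\<close> for all \<open>t\<close> in a compact set. Near a given \<open>t\<close>
  the product \<open>L C\<close> works, where \<open>L \<subseteq> U t\<^sup>-\<^sup>1\<close> is compact of measure above \<open>c\<close> and \<open>C\<close> is a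
  compact neighbourhood of \<open>t\<close> with \<open>L C \<subseteq> U\<close>; finitely many of these neighbourhoods cover \<open>T\<close>.
\<close>

lemma compact_subset_translates_gt:
  fixes M :: "'a::{topological_group_add, t2_space} measure"
  assumes lc: "locally_compact_space (euclidean :: 'a topology)"
    and M: "radon M" and U: "open U" and T: "compact T"
    and gt: "\<And>t. t \<in> T \<Longrightarrow> c < emeasure M {s. s + t \<in> U}"
  obtains K where "compact K" "K \<subseteq> U" "\<And>t. t \<in> T \<Longrightarrow> c < emeasure M {s. s + t \<in> K}"
proof -
  have nb: "neighbourhood_base_of (compactin euclidean) (euclidean :: 'a topology)"
    by (rule iffD1[OF locally_compact_space_neighbourhood_base[OF disjI1[OF euclidean_Hausdorff]] lc])
  have "\<forall>t\<in>T. \<exists>W K. open W \<and> t \<in> W \<and> compact K \<and> K \<subseteq> U \<and> (\<forall>t'\<in>W. c < emeasure M {s. s + t' \<in> K})"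
  proof
    fix t assume t: "t \<in> T"
    obtain L where L: "compact L" "L \<subseteq> {s. s + t \<in> U}" "c < emeasure M L"
      by (rule radon_less_compact[OF M borel_open[OF open_translate[OF U]] gt[OF t]])
    obtain V where V: "open V" "t \<in> V" "\<forall>s\<in>L. \<forall>t'\<in>V. s + t' \<in> U"
      by (rule open_compact_translates[OF L(1) U subsetD[OF L(2), unfolded mem_Collect_eq]])
    obtain W C where W: "open W" "compact C" "t \<in> W" "W \<subseteq> C" "C \<subseteq> V"
    proof -
      have "openin euclidean V \<and> t \<in> V" using V(1,2) by simp
      from iffD1[OF neighbourhood_base_of nb, rule_format, OF this] show thesis
        by (elim exE conjE) (rule that; simp)
    qed
    define K where "K = (\<lambda>(s, t). s + t) ` (L \<times> C)"
    have "compact K"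
      unfolding K_def
      by (rule compact_continuous_image[OF continuous_on_subset[OF continuous_group_add subset_UNIV]
            compact_Times[OF L(1) W(2)]])
    moreover have "K \<subseteq> U" using V(3) W(5) by (auto simp: K_def)
    moreover have "c < emeasure M {s. s + t' \<in> K}" if "t' \<in> W" for t'
    proof (rule less_le_trans[OF L(3) emeasure_mono])
      show "L \<subseteq> {s. s + t' \<in> K}" using W(4) that by (auto simp: K_def)
      show "{s. s + t' \<in> K} \<in> sets M"
        using \<open>compact K\<close> radon_sets[OF M] by (simp add: translate_borel)
    qed
    ultimately show "\<exists>W K. open W \<and> t \<in> W \<and> compact K \<and> K \<subseteq> U \<and> (\<forall>t'\<in>W. c < emeasure M {s. s + t' \<in> K})"
      using W by blast
  qed
  from bchoice[OF this] obtain W where W: "\<forall>t\<in>T. \<exists>K. open (W t) \<and> t \<in> W t \<and> compact K \<and> K \<subseteq> U \<and>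
      (\<forall>t'\<in>W t. c < emeasure M {s. s + t' \<in> K})" by blast
  from bchoice[OF this] obtain K where WK: "\<forall>t\<in>T. open (W t) \<and> t \<in> W t \<and> compact (K t) \<and> K t \<subseteq> U \<and>
      (\<forall>t'\<in>W t. c < emeasure M {s. s + t' \<in> K t})" by blast
  obtain D where D: "D \<subseteq> T" "finite D" "T \<subseteq> (\<Union>t\<in>D. W t)"
  proof (rule compactE_image[OF T, of T W])
    show "open (W t)" if "t \<in> T" for t using WK that by blast
    show "T \<subseteq> (\<Union>t\<in>T. W t)" using WK by blast
  qed
  have "compact (\<Union>t\<in>D. K t)" using D(1) WK by (intro compact_UN D(2)) blast
  moreover have "c < emeasure M {s. s + t' \<in> (\<Union>t\<in>D. K t)}" if t': "t' \<in> T" for t'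
  proof -
    obtain t where t: "t \<in> D" "t' \<in> W t" using D(3) t' by blast
    have "c < emeasure M {s. s + t' \<in> K t}" using WK t D(1) by blast
    also have "\<dots> \<le> emeasure M {s. s + t' \<in> (\<Union>t\<in>D. K t)}"
    proof (rule emeasure_mono)
      show "{s. s + t' \<in> K t} \<subseteq> {s. s + t' \<in> (\<Union>t\<in>D. K t)}" using t(1) by blast
      show "{s. s + t' \<in> (\<Union>t\<in>D. K t)} \<in> sets M"
        using \<open>compact (\<Union>t\<in>D. K t)\<close> unfolding radon_sets[OF M]
        by (intro translate_borel compact_borel)
    qed
    finally show ?thesis .
  qed
  moreover have "(\<Union>t\<in>D. K t) \<subseteq> U" using D(1) WK by blast
  ultimately show thesis using that by blast
qed

text \<open>
  It suffices to approximate an open set \<open>U\<close>. The values of \<open>t \<mapsto> M(U t\<^sup>-\<^sup>1)\<close> are cut into levels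
  of height \<open>e\<close>. Up to small \<open>N\<close>-measure each superlevel set is compact, and on that compact
  set \<open>U\<close> can be replaced by a compact subset of \<open>U\<close>. The union \<open>L\<close> of these subsets loses at most
  \<open>e\<close> for every \<open>t\<close> outside a set \<open>R\<close> of small measure.
\<close>

lemma radon_conv_measure:
  fixes M N :: "'a::{topological_group_add, t2_space} measure"
  assumes lc: "locally_compact_space (euclidean :: 'a topology)" and M: "radon M" and N: "radon N"
  shows "radon (conv_measure M N)"
proof (rule radon_of_inner_on_open)
  interpret M: finite_measure M using M by (rule radon_finite_measure)
  interpret N: finite_measure N using N by (rule radon_finite_measure)
  have space: "space M = UNIV" "space N = UNIV"
    using sets_eq_imp_space_eq[OF radon_sets[OF M]] sets_eq_imp_space_eq[OF radon_sets[OF N]] by simp_all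
  note [measurable_cong] = radon_sets[OF M] radon_sets[OF N]
  show "sets (conv_measure M N) = sets borel" by simp
  have "emeasure (conv_measure M N) UNIV = emeasure M UNIV * emeasure N UNIV"
    using emeasure_conv_measure[OF M radon_sets[OF N], of UNIV] space by simp
  then show "emeasure (conv_measure M N) UNIV < \<infinity>"
    using radon_finite[OF M] radon_finite[OF N] by (simp add: ennreal_mult_less_top)
  fix U :: "'a set" and \<epsilon> :: real
  assume U: "open U" and \<epsilon>: "0 < \<epsilon>"
  define a b where "a = measure M UNIV" and "b = measure N UNIV"
  have ab: "0 \<le> a" "0 \<le> b" by (simp_all add: a_def b_def)
  define e where "e = \<epsilon> / (a + b + 1)"
  have e: "0 < e" using \<epsilon> ab by (simp add: e_def)
  \<comment> \<open>\<open>n\<close> levels of height \<open>e\<close> exhaust the range \<open>[0, a]\<close>; \<open>Q k\<close> is the set above level \<open>k\<close>\<close>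
  define n where "n = nat \<lceil>a / e\<rceil>"
  define Q where "Q k = {t. ennreal (real k * e) < emeasure M {s. s + t \<in> U}}" for k :: nat
  have Q: "Q k \<in> sets borel" for k
    unfolding Q_def by (intro borel_open open_emeasure_translate_gt M U)
  have "\<forall>k. \<exists>T. compact T \<and> T \<subseteq> Q k \<and> emeasure N (Q k - T) \<le> ennreal (e / (real n + 1))"
  proof
    fix k show "\<exists>T. compact T \<and> T \<subseteq> Q k \<and> emeasure N (Q k - T) \<le> ennreal (e / (real n + 1))"
      by (rule radonD[OF N Q, of "e / (real n + 1)"]) (use e in auto)
  qed
  then obtain T where T: "\<forall>k. compact (T k) \<and> T k \<subseteq> Q k \<and> emeasure N (Q k - T k) \<le> ennreal (e / (real n + 1))"
    by (auto dest: choice)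
  have "\<forall>k. \<exists>K. compact K \<and> K \<subseteq> U \<and> (\<forall>t\<in>T k. ennreal (real k * e) < emeasure M {s. s + t \<in> K})"
  proof
    fix k
    have Tk: "compact (T k)" "T k \<subseteq> Q k" using T by auto
    show "\<exists>K. compact K \<and> K \<subseteq> U \<and> (\<forall>t\<in>T k. ennreal (real k * e) < emeasure M {s. s + t \<in> K})"
      by (rule compact_subset_translates_gt[OF lc M U Tk(1), of "ennreal (real k * e)"])
        (use Tk(2) Q_def in auto)
  qed
  then obtain K where K: "\<forall>k. compact (K k) \<and> K k \<subseteq> U \<and>
      (\<forall>t\<in>T k. ennreal (real k * e) < emeasure M {s. s + t \<in> K k})"
    by (auto dest: choice)
  define L where "L = (\<Union>k<n. K k)"
  define R where "R = (\<Union>k<n. Q k - T k)"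
  have L: "compact L" "L \<subseteq> U" using K by (auto simp: L_def)
  have Tb: "T k \<in> sets borel" for k using T by (intro compact_borel) blast
  have QT: "Q k - T k \<in> sets borel" for k using Q Tb by (intro sets.Diff)
  have R: "R \<in> sets borel" unfolding R_def using QT by (intro sets.finite_UN) simp_all
  have "emeasure N R \<le> (\<Sum>k<n. emeasure N (Q k - T k))"
    unfolding R_def using QT radon_sets[OF N] by (intro emeasure_subadditive_finite) auto
  also have "\<dots> \<le> (\<Sum>k<n. ennreal (e / (real n + 1)))" using T by (intro sum_mono) auto
  also have "\<dots> = ennreal (real n * (e / (real n + 1)))"
    using e by (subst sum_ennreal) simp_all
  also have "\<dots> \<le> ennreal e" using e by (intro ennreal_leI) (simp add: field_simps)
  finally have NR: "emeasure N R \<le> ennreal e" .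
  have pointwise: "emeasure M {s. s + t \<in> U - L} \<le> ennreal e + ennreal a * indicator R t" for t
  proof (cases "t \<in> R")
    case True
    have "emeasure M {s. s + t \<in> U - L} \<le> emeasure M UNIV"
      using radon_sets[OF M] by (intro emeasure_mono) auto
    also have "\<dots> = ennreal a" by (simp add: a_def M.emeasure_eq_measure)
    also have "\<dots> \<le> ennreal e + ennreal a * indicator R t" using True by simp
    finally show ?thesis .
  next
    case False
    define v where "v = measure M {s. s + t \<in> U}"
    have sets: "{s. s + t \<in> U} \<in> sets M" "{s. s + t \<in> L} \<in> sets M"
      unfolding radon_sets[OF M]
      by (rule translate_borel[OF borel_open[OF U]] translate_borel[OF compact_borel[OF L(1)]])+
    have "measure M {s. s + t \<in> U - L} \<le> e"
    proof (cases "v = 0")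
      case True
      have "measure M {s. s + t \<in> U - L} \<le> v"
        unfolding v_def using sets by (intro M.finite_measure_mono) auto
      then show ?thesis using True e by simp
    next
      case v: False
      then have v: "0 < v" by (simp add: v_def less_le)
      have "v \<le> a"
        unfolding v_def a_def using radon_sets[OF M] by (intro M.finite_measure_mono) auto
      then have le: "\<lceil>v / e\<rceil> \<le> \<lceil>a / e\<rceil>" using e by (intro ceiling_mono divide_right_mono) auto
      have pos: "1 \<le> \<lceil>v / e\<rceil>" using v e by (simp add: one_le_ceiling)
      \<comment> \<open>the level of \<open>v\<close>, chosen so that \<open>k e < v \<le> (k + 1) e\<close> with the strict inequality required in \<open>Q k\<close>\<close>
      define k where "k = nat (\<lceil>v / e\<rceil> - 1)"
      have k: "k < n" using le pos unfolding k_def n_def by linarith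
      have real_k: "real k = of_int \<lceil>v / e\<rceil> - 1" using pos unfolding k_def by linarith
      have kv: "real k < v / e" "v / e \<le> real k + 1"
        unfolding real_k using ceiling_correct[of "v / e"] by auto
      then have kv': "real k * e < v" "v \<le> real k * e + e"
        using e by (simp_all add: field_simps)
      have "t \<in> Q k"
        using kv'(1) e v by (simp add: Q_def v_def M.emeasure_eq_measure ennreal_less_iff)
      with False k have "t \<in> T k" by (auto simp: R_def)
      then have "ennreal (real k * e) < emeasure M {s. s + t \<in> K k}" using K by auto
      also have "\<dots> \<le> emeasure M {s. s + t \<in> L}"
        using k sets by (intro emeasure_mono) (auto simp: L_def)
      finally have "real k * e < measure M {s. s + t \<in> L}"
        using e by (simp add: M.emeasure_eq_measure ennreal_less_iff)
      moreover have "measure M ({s. s + t \<in> U} - {s. s + t \<in> L}) = v - measure M {s. s + t \<in> L}"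
        unfolding v_def using sets L(2) by (intro M.finite_measure_Diff) auto
      moreover have "{s. s + t \<in> U} - {s. s + t \<in> L} = {s. s + t \<in> U - L}" by auto
      ultimately show ?thesis using kv'(2) by simp
    qed
    then show ?thesis using False by (simp add: M.emeasure_eq_measure ennreal_leI)
  qed
  have "emeasure (conv_measure M N) (U - L) = (\<integral>\<^sup>+ t. emeasure M {s. s + t \<in> U - L} \<partial>N)"
    using U L(1) by (intro emeasure_conv_measure[OF M radon_sets[OF N]]) auto
  also have "\<dots> \<le> (\<integral>\<^sup>+ t. ennreal e + ennreal a * indicator R t \<partial>N)"
    by (intro nn_integral_mono pointwise)
  also have "\<dots> = ennreal e * emeasure N UNIV + ennreal a * emeasure N R"
    using R space radon_sets[OF N] by (simp add: nn_integral_add nn_integral_cmult_indicator)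
  also have "\<dots> \<le> ennreal e * ennreal b + ennreal a * ennreal e"
    by (intro add_mono mult_left_mono NR) (simp_all add: b_def N.emeasure_eq_measure)
  also have "\<dots> = ennreal (e * (a + b))"
    using e ab by (simp add: distrib_left ennreal_plus ennreal_mult less_imp_le mult.commute add.commute)
  also have "\<dots> \<le> ennreal \<epsilon>"
    using \<epsilon> ab by (intro ennreal_leI) (simp add: e_def field_simps)
  finally show "\<exists>K. compact K \<and> K \<subseteq> U \<and> emeasure (conv_measure M N) (U - K) \<le> ennreal \<epsilon>"
    using L by blast
qed

section \<open>The weighted measure algebra\<close>

lemma weight_ge_1: "weight \<omega> \<Longrightarrow> 1 \<le> \<omega> t"
  and weight_add_le: "weight \<omega> \<Longrightarrow> \<omega> (s + t) \<le> \<omega> s * \<omega> t"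
  by (simp_all add: weight_def)

lemma weight_measurable:
  assumes "weight \<omega>" shows "(\<lambda>t. ennreal (\<omega> t)) \<in> borel_measurable borel"
proof -
  have [measurable]: "\<omega> \<in> borel_measurable borel" using assms by (simp add: weight_def)
  show ?thesis by measurable
qed

text \<open>
  Since \<open>\<omega> \<ge> 1\<close>, a finite weighted norm makes the total variation finite, so that regularity
  means being a Radon measure in the present sense.
\<close>

lemma M_weighted_iff:
  fixes \<mu> :: "'a::{topological_group_add, t2_space} set \<Rightarrow> complex"
  assumes \<omega>: "weight \<omega>"
  shows "\<mu> \<in> M_weighted \<omega> \<longleftrightarrow> complex_borel_measure \<mu> \<and> radon (total_variation \<mu>) \<and>
     (\<integral>\<^sup>+ t. ennreal (\<omega> t) \<partial>total_variation \<mu>) < \<infinity>"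
proof -
  have "emeasure (total_variation \<mu>) UNIV < \<infinity>"
    if "(\<integral>\<^sup>+ t. ennreal (\<omega> t) \<partial>total_variation \<mu>) < \<infinity>"
  proof -
    have "emeasure (total_variation \<mu>) UNIV = (\<integral>\<^sup>+ t. 1 \<partial>total_variation \<mu>)" by simp
    also have "\<dots> \<le> (\<integral>\<^sup>+ t. ennreal (\<omega> t) \<partial>total_variation \<mu>)"
      using weight_ge_1[OF \<omega>] by (intro nn_integral_mono) simp
    finally show ?thesis using that by simp
  qed
  then show ?thesis
    using regular_measure_iff_radon[of \<mu>]
    by (auto simp: M_weighted_def regular_complex_measures_def)
qed

lemma M_weightedD:
  fixes \<mu> :: "'a::{topological_group_add, t2_space} set \<Rightarrow> complex"
  assumes "weight \<omega>" "\<mu> \<in> M_weighted \<omega>"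
  shows "complex_borel_measure \<mu>" "radon (total_variation \<mu>)"
    "emeasure (total_variation \<mu>) UNIV < \<infinity>"
    "(\<integral>\<^sup>+ t. ennreal (\<omega> t) \<partial>total_variation \<mu>) < \<infinity>"
  using assms radon_finite by (auto simp: M_weighted_iff)

text \<open>
  The criterion by which sums, scalar multiples, convolutions and point masses are all seen
  to belong to the algebra.
\<close>

lemma M_weighted_dominated:
  fixes \<mu> :: "'a::{topological_group_add, t2_space} set \<Rightarrow> complex" and c d :: real
  assumes \<omega>: "weight \<omega>" and \<mu>: "complex_borel_measure \<mu>"
    and N: "radon N1" "radon N2"
      "(\<integral>\<^sup>+ t. ennreal (\<omega> t) \<partial>N1) < \<infinity>" "(\<integral>\<^sup>+ t. ennreal (\<omega> t) \<partial>N2) < \<infinity>"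
    and cd: "0 \<le> c" "0 \<le> d"
    and dom: "\<And>E. E \<in> sets borel \<Longrightarrow>
      emeasure (total_variation \<mu>) E \<le> ennreal c * emeasure N1 E + ennreal d * emeasure N2 E"
  shows "\<mu> \<in> M_weighted \<omega>"
proof -
  have "radon (total_variation \<mu>)"
    by (rule radon_dominated[OF N(1,2) sets_total_variation cd dom])
  moreover have "(\<integral>\<^sup>+ t. ennreal (\<omega> t) \<partial>total_variation \<mu>) \<le>
      ennreal c * (\<integral>\<^sup>+ t. ennreal (\<omega> t) \<partial>N1) + ennreal d * (\<integral>\<^sup>+ t. ennreal (\<omega> t) \<partial>N2)"
    by (rule nn_integral_le_dominated[OF sets_total_variation radon_sets radon_sets dom
          weight_measurable[OF \<omega>]]) (rule N)+
  moreover have "\<dots> < \<infinity>" using N(3,4) by (simp add: ennreal_mult_less_top)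
  ultimately show ?thesis using \<mu> by (auto simp: M_weighted_iff[OF \<omega>] intro: le_less_trans)
qed

lemma suminf_norm_le_total_variation:
  assumes "complex_borel_measure \<mu>" "A \<in> borel_partitions E" "E \<in> sets borel"
  shows "(\<Sum>i. ennreal (cmod (\<mu> (A i)))) \<le> emeasure (total_variation \<mu>) E"
  unfolding emeasure_total_variation[OF assms(1,3)] using assms(2) by (rule SUP_upper)

lemma M_weighted_linear:
  fixes \<mu> \<nu> :: "'a::{topological_group_add, t2_space} set \<Rightarrow> complex"
  assumes \<omega>: "weight \<omega>" and \<mu>: "\<mu> \<in> M_weighted \<omega>" and \<nu>: "\<nu> \<in> M_weighted \<omega>"
  shows "(\<lambda>E. c * \<mu> E + d * \<nu> E) \<in> M_weighted \<omega>"
proof (rule M_weighted_dominated[OF \<omega>, where c = "cmod c" and d = "cmod d"])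
  note m = M_weightedD[OF \<omega> \<mu>] and n = M_weightedD[OF \<omega> \<nu>]
  show cbm: "complex_borel_measure (\<lambda>E. c * \<mu> E + d * \<nu> E)"
    using m(1) n(1) by (simp add: complex_borel_measure_def sums_add sums_mult)
  show "radon (total_variation \<mu>)" "radon (total_variation \<nu>)"
    "(\<integral>\<^sup>+ t. ennreal (\<omega> t) \<partial>total_variation \<mu>) < \<infinity>"
    "(\<integral>\<^sup>+ t. ennreal (\<omega> t) \<partial>total_variation \<nu>) < \<infinity>" by (fact m n)+
  show "0 \<le> cmod c" "0 \<le> cmod d" by simp_all
  fix E :: "'a set" assume E: "E \<in> sets borel"
  show "emeasure (total_variation (\<lambda>E. c * \<mu> E + d * \<nu> E)) E \<le>
    ennreal (cmod c) * emeasure (total_variation \<mu>) E + ennreal (cmod d) * emeasure (total_variation \<nu>) E"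
  proof (rule total_variation_minimal[OF cbm E])
    fix A assume A: "A \<in> borel_partitions E"
    have le: "ennreal (cmod (c * x + d * y)) \<le> ennreal (cmod c) * ennreal (cmod x) + ennreal (cmod d) * ennreal (cmod y)" for x y
      using norm_triangle_ineq[of "c * x" "d * y"]
      by (simp add: norm_mult flip: ennreal_mult ennreal_plus)
    have "(\<Sum>i. ennreal (cmod (c * \<mu> (A i) + d * \<nu> (A i)))) \<le>
        (\<Sum>i. ennreal (cmod c) * ennreal (cmod (\<mu> (A i))) + ennreal (cmod d) * ennreal (cmod (\<nu> (A i))))"
      by (intro suminf_le le) auto
    also have "\<dots> = ennreal (cmod c) * (\<Sum>i. ennreal (cmod (\<mu> (A i)))) + ennreal (cmod d) * (\<Sum>i. ennreal (cmod (\<nu> (A i))))"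
      by (subst suminf_add[symmetric]) simp_all
    also have "\<dots> \<le> ennreal (cmod c) * emeasure (total_variation \<mu>) E + ennreal (cmod d) * emeasure (total_variation \<nu>) E"
      by (intro add_mono mult_left_mono suminf_norm_le_total_variation m n A E) simp_all
    finally show "(\<Sum>i. ennreal (cmod (c * \<mu> (A i) + d * \<nu> (A i)))) \<le> \<dots>" .
  qed
qed

lemma measurable_complex_translate:
  fixes \<mu> :: "'a::{topological_group_add, t2_space} set \<Rightarrow> complex"
  assumes \<mu>: "complex_borel_measure \<mu>" "radon (total_variation \<mu>)" and E: "E \<in> sets borel"
  shows "(\<lambda>t. \<mu> {s. s + t \<in> E}) \<in> borel_measurable borel"
proof -
  have "radon (jordan_part j \<mu>)" for j
    by (rule radon_le[OF \<mu>(2)]) (simp_all add: jordan_part_le_total_variation[OF \<mu>(1)])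
  then have [measurable]: "(\<lambda>t. emeasure (jordan_part j \<mu>) {s. s + t \<in> E}) \<in> borel_measurable borel" for j
    using E by (rule measurable_emeasure_translate)
  have "(\<lambda>t. \<mu> {s. s + t \<in> E}) =
      (\<lambda>t. \<Sum>j<4. \<i> ^ j * of_real (enn2real (emeasure (jordan_part j \<mu>) {s. s + t \<in> E})))"
    using complex_measure_jordan[OF \<mu>(1) radon_finite[OF \<mu>(2)] translate_borel[OF E]]
    by (simp add: measure_def)
  also have "\<dots> \<in> borel_measurable borel" by measurable
  finally show ?thesis .
qed

text \<open>
  Dominated convergence: the partial sums of \<open>t \<mapsto> \<mu>(A\<^sub>i t\<^sup>-\<^sup>1)\<close> are bounded by the total mass
  of \<open>|\<mu>|\<close>.
\<close>

lemma complex_borel_measure_convolve: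
  fixes \<mu> \<nu> :: "'a::{topological_group_add, t2_space} set \<Rightarrow> complex"
  assumes \<mu>: "complex_borel_measure \<mu>" "radon (total_variation \<mu>)"
    and \<nu>: "complex_borel_measure \<nu>" "radon (total_variation \<nu>)"
  shows "complex_borel_measure (convolve \<mu> \<nu>)"
  unfolding complex_borel_measure_def
proof (intro conjI allI impI)
  fix A :: "nat \<Rightarrow> 'a set" assume A: "range A \<subseteq> sets borel" "disjoint_family A"
  define B where "B = measure (total_variation \<mu>) UNIV"
  have B: "emeasure (total_variation \<mu>) UNIV = ennreal B"
    using radon_finite[OF \<mu>(2)] by (simp add: B_def emeasure_eq_ennreal_measure less_top[symmetric])
  have preimage: "range (\<lambda>i. {s. s + t \<in> A i}) \<subseteq> sets borel" "disjoint_family (\<lambda>i. {s. s + t \<in> A i})"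
      "(\<Union>i. {s. s + t \<in> A i}) = {s. s + t \<in> (\<Union>i. A i)}" for t
    using A by (auto simp: disjoint_family_on_def translate_borel)
  have bound: "(\<Sum>i<n. cmod (\<mu> {s. s + t \<in> A i})) \<le> B" for n t
  proof -
    have "ennreal (\<Sum>i<n. cmod (\<mu> {s. s + t \<in> A i})) = (\<Sum>i<n. ennreal (cmod (\<mu> {s. s + t \<in> A i})))"
      by (simp add: sum_ennreal)
    also have "\<dots> \<le> (\<Sum>i. ennreal (cmod (\<mu> {s. s + t \<in> A i})))"
      by (rule sum_le_suminf) auto
    also have "\<dots> \<le> emeasure (total_variation \<mu>) {s. s + t \<in> (\<Union>i. A i)}"
      using preimage[of t] A(1) by (intro suminf_norm_le_total_variation \<mu> translate_borel)
        (auto simp: borel_partitions_def)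
    also have "\<dots> \<le> emeasure (total_variation \<mu>) UNIV" by (intro emeasure_mono) auto
    finally show ?thesis by (simp add: B B_def)
  qed
  have "(\<lambda>i. complex_integral \<nu> (\<lambda>t. \<mu> {s. s + t \<in> A i})) sums
      complex_integral \<nu> (\<lambda>t. \<mu> {s. s + t \<in> (\<Union>i. A i)})"
  proof (rule complex_integral_sums[OF \<nu>(1) radon_finite[OF \<nu>(2)]])
    show "(\<lambda>t. \<mu> {s. s + t \<in> A i}) \<in> borel_measurable borel" for i
      using A by (intro measurable_complex_translate \<mu>) auto
    show "(\<lambda>t. \<mu> {s. s + t \<in> (\<Union>i. A i)}) \<in> borel_measurable borel"
      using A by (intro measurable_complex_translate \<mu>) auto
    show "cmod (\<mu> {s. s + t \<in> A i}) \<le> B" for i t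
      using order_trans[OF member_le_sum[of i "{..<Suc i}" "\<lambda>i. cmod (\<mu> {s. s + t \<in> A i})"] bound[of t "Suc i"]]
      by simp
    show "(\<lambda>i. \<mu> {s. s + t \<in> A i}) sums \<mu> {s. s + t \<in> (\<Union>i. A i)}" for t
      using complex_borel_measure_sums[OF \<mu>(1) preimage(1,2)] unfolding preimage(3) .
    show "cmod (\<Sum>i<n. \<mu> {s. s + t \<in> A i}) \<le> B" for n t
      using norm_sum bound by (rule order_trans)
  qed
  then show "(\<lambda>i. convolve \<mu> \<nu> (A i)) sums convolve \<mu> \<nu> (\<Union>i. A i)"
    using A(1) by (simp add: convolve_def range_subsetD sets.countable_UN)
qed (simp add: convolve_def)

text \<open>
  The sharp constant is \<open>1\<close>; the factor \<open>4\<close> counts the Jordan parts, each of which is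
  dominated by the total variation, and is harmless for membership in the algebra.
\<close>

lemma total_variation_convolve_le:
  fixes \<mu> \<nu> :: "'a::{topological_group_add, t2_space} set \<Rightarrow> complex"
  assumes \<mu>: "complex_borel_measure \<mu>" "radon (total_variation \<mu>)"
    and \<nu>: "complex_borel_measure \<nu>" "radon (total_variation \<nu>)" and E: "E \<in> sets borel"
  shows "emeasure (total_variation (convolve \<mu> \<nu>)) E
           \<le> 4 * emeasure (conv_measure (total_variation \<mu>) (total_variation \<nu>)) E"
proof (rule total_variation_minimal[OF complex_borel_measure_convolve[OF \<mu> \<nu>] E])
  let ?C = "conv_measure (total_variation \<mu>) (total_variation \<nu>)"
  have le: "ennreal (cmod (convolve \<mu> \<nu> F)) \<le> 4 * emeasure ?C F" if F: "F \<in> sets borel" for F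
  proof -
    have "ennreal (cmod (convolve \<mu> \<nu> F)) \<le>
        4 * (\<integral>\<^sup>+ t. ennreal (cmod (\<mu> {s. s + t \<in> F})) \<partial>total_variation \<nu>)"
      using norm_complex_integral_le[OF \<nu>(1) measurable_complex_translate[OF \<mu> F]] F
      by (simp add: convolve_def)
    also have "\<dots> \<le> 4 * (\<integral>\<^sup>+ t. emeasure (total_variation \<mu>) {s. s + t \<in> F} \<partial>total_variation \<nu>)"
      by (intro mult_left_mono nn_integral_mono norm_le_total_variation \<mu>) simp
    finally show ?thesis
      by (simp add: emeasure_conv_measure[OF \<mu>(2) sets_total_variation F])
  qed
  fix A assume A: "A \<in> borel_partitions E"
  then have A': "range A \<subseteq> sets borel" "disjoint_family A" "(\<Union>i. A i) = E"
    by (auto simp: borel_partitions_def)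
  have "(\<Sum>i. ennreal (cmod (convolve \<mu> \<nu> (A i)))) \<le> (\<Sum>i. 4 * emeasure ?C (A i))"
    using A' by (intro suminf_le le) auto
  also have "\<dots> = 4 * emeasure ?C E"
    using A' suminf_emeasure[of A ?C] by simp
  finally show "(\<Sum>i. ennreal (cmod (convolve \<mu> \<nu> (A i)))) \<le> 4 * emeasure ?C E" .
qed

lemma M_weighted_convolve:
  fixes \<mu> \<nu> :: "'a::{topological_group_add, t2_space} set \<Rightarrow> complex"
  assumes lc: "locally_compact_space (euclidean :: 'a topology)" and \<omega>: "weight \<omega>"
    and \<mu>: "\<mu> \<in> M_weighted \<omega>" and \<nu>: "\<nu> \<in> M_weighted \<omega>"
  shows "convolve \<mu> \<nu> \<in> M_weighted \<omega>"
proof -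
  note m = M_weightedD[OF \<omega> \<mu>] and n = M_weightedD[OF \<omega> \<nu>]
  let ?C = "conv_measure (total_variation \<mu>) (total_variation \<nu>)"
  have C: "radon ?C" by (rule radon_conv_measure[OF lc m(2) n(2)])
  note [measurable] = weight_measurable[OF \<omega>]
  have "(\<integral>\<^sup>+ u. ennreal (\<omega> u) \<partial>?C) =
      (\<integral>\<^sup>+ t. \<integral>\<^sup>+ s. ennreal (\<omega> (s + t)) \<partial>total_variation \<mu> \<partial>total_variation \<nu>)"
    using nn_integral_conv_measure[OF m(2) sets_total_variation weight_measurable[OF \<omega>]] by blast
  also have "\<dots> \<le> (\<integral>\<^sup>+ t. \<integral>\<^sup>+ s. ennreal (\<omega> t) * ennreal (\<omega> s) \<partial>total_variation \<mu> \<partial>total_variation \<nu>)"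
  proof (intro nn_integral_mono)
    fix s t
    have "0 \<le> \<omega> s" "0 \<le> \<omega> t" using weight_ge_1[OF \<omega>, of s] weight_ge_1[OF \<omega>, of t] by auto
    then show "ennreal (\<omega> (s + t)) \<le> ennreal (\<omega> t) * ennreal (\<omega> s)"
      using weight_add_le[OF \<omega>, of s t] by (simp add: mult.commute ennreal_leI flip: ennreal_mult)
  qed
  also have "\<dots> = (\<integral>\<^sup>+ t. ennreal (\<omega> t) \<partial>total_variation \<nu>) * (\<integral>\<^sup>+ s. ennreal (\<omega> s) \<partial>total_variation \<mu>)"
    by (simp add: nn_integral_cmult nn_integral_multc)
  also have "\<dots> < \<infinity>" using m(4) n(4) by (simp add: ennreal_mult_less_top)
  finally have "(\<integral>\<^sup>+ u. ennreal (\<omega> u) \<partial>?C) < \<infinity>" .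
  then show ?thesis
    by (intro M_weighted_dominated[OF \<omega> complex_borel_measure_convolve[OF m(1,2) n(1,2)] C C, of 4 0])
      (use total_variation_convolve_le[OF m(1,2) n(1,2)] in simp_all)
qed

section \<open>Atoms and countable subgroups\<close>

lemma countable_borel: "countable Z \<Longrightarrow> Z \<in> sets borel" for Z :: "'a::t2_space set"
  by (rule sets.countable) auto

definition atoms :: "('a set \<Rightarrow> complex) \<Rightarrow> 'a set" where
  "atoms \<mu> = {t. \<mu> {t} \<noteq> 0}"

lemma countable_atoms:
  fixes \<mu> :: "'a::t2_space set \<Rightarrow> complex"
  assumes \<mu>: "complex_borel_measure \<mu>" "emeasure (total_variation \<mu>) UNIV < \<infinity>"
  shows "countable (atoms \<mu>)"
proof -
  interpret finite_measure "total_variation \<mu>" using \<mu>(2) by (intro finite_measureI) simp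
  have "atoms \<mu> \<subseteq> {t. measure (total_variation \<mu>) {t} \<noteq> 0}"
  proof
    fix t assume t: "t \<in> atoms \<mu>"
    then have "0 < ennreal (cmod (\<mu> {t}))" by (simp add: atoms_def)
    also have "\<dots> \<le> emeasure (total_variation \<mu>) {t}" by (rule norm_le_total_variation[OF \<mu>(1)])
    finally show "t \<in> {t. measure (total_variation \<mu>) {t} \<noteq> 0}" by (simp add: emeasure_eq_measure)
  qed
  then show ?thesis using countable_support by (rule countable_subset)
qed

lemma null_countable_without_atoms:
  fixes \<mu> :: "'a::t2_space set \<Rightarrow> complex"
  assumes \<mu>: "complex_borel_measure \<mu>" and Z: "countable Z" "Z \<inter> atoms \<mu> = {}"
  shows "Z \<in> null_sets (total_variation \<mu>)"
proof -
  have "{z} \<in> null_sets (total_variation \<mu>)" if "z \<in> Z" for z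
  proof -
    have z: "\<mu> {z} = 0" using that Z(2) by (auto simp: atoms_def)
    have "emeasure (total_variation \<mu>) {z} \<le> 0"
    proof (rule total_variation_minimal[OF \<mu>])
      fix A assume "A \<in> borel_partitions {z}"
      then have "A i \<subseteq> {z}" for i by (auto simp: borel_partitions_def)
      then have "A i = {} \<or> A i = {z}" for i by (simp add: subset_singleton_iff)
      then have "\<mu> (A i) = 0" for i using z complex_borel_measure_empty[OF \<mu>] by metis
      then show "(\<Sum>i. ennreal (cmod (\<mu> (A i)))) \<le> 0" by simp
    qed simp
    then show ?thesis by (simp add: null_sets_def)
  qed
  then have "(\<Union>z\<in>Z. {z}) \<in> null_sets (total_variation \<mu>)"
    by (rule null_sets_UN'[OF Z(1)])
  then show ?thesis by simp
qed

lemma measure_zero_of_null: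
  assumes "complex_borel_measure \<mu>" "Z \<in> null_sets (total_variation \<mu>)"
  shows "\<mu> Z = 0"
  using norm_le_total_variation[OF assms(1), of Z] assms(2) by (simp add: null_setsD1)

definition discrete_mass :: "('a set \<Rightarrow> complex) \<Rightarrow> complex" where
  "discrete_mass \<mu> = \<mu> (atoms \<mu>)"

lemma discrete_mass_eq:
  fixes \<mu> :: "'a::t2_space set \<Rightarrow> complex"
  assumes \<mu>: "complex_borel_measure \<mu>" and D: "countable D" "atoms \<mu> \<subseteq> D"
  shows "\<mu> D = discrete_mass \<mu>"
proof -
  have "countable (D - atoms \<mu>)" "countable (atoms \<mu>)"
    using D by (auto intro: countable_subset)
  then have "\<mu> (atoms \<mu> \<union> (D - atoms \<mu>)) = \<mu> (atoms \<mu>) + \<mu> (D - atoms \<mu>)"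
    by (intro complex_borel_measure_Un \<mu> countable_borel) auto
  moreover have "\<mu> (D - atoms \<mu>) = 0"
    by (rule measure_zero_of_null[OF \<mu> null_countable_without_atoms[OF \<mu>]])
      (use \<open>countable (D - atoms \<mu>)\<close> in auto)
  moreover have "atoms \<mu> \<union> (D - atoms \<mu>) = D" using D(2) by auto
  ultimately show ?thesis by (simp add: discrete_mass_def)
qed

definition countable_subgroup :: "'a::group_add set \<Rightarrow> bool" where
  "countable_subgroup D \<longleftrightarrow>
     countable D \<and> 0 \<in> D \<and> (\<forall>s\<in>D. \<forall>t\<in>D. s + t \<in> D) \<and> (\<forall>s\<in>D. - s \<in> D)"

lemma minus_sum_list: "- sum_list xs = sum_list (map uminus (rev xs))"
  for xs :: "'a::group_add list"
  by (induction xs) (simp_all add: minus_add)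

lemma countable_subgroup_exists:
  fixes S :: "'a::group_add set"
  assumes "countable S"
  obtains D where "countable_subgroup D" "S \<subseteq> D"
proof -
  define X where "X = S \<union> uminus ` S"
  define D where "D = sum_list ` lists X"
  have "countable D" using assms by (auto simp: D_def X_def intro!: countable_image countable_lists)
  moreover have "0 \<in> D" unfolding D_def by (rule image_eqI[of _ _ "[]"]) auto
  moreover have "s + t \<in> D" if st: "s \<in> D" "t \<in> D" for s t
  proof -
    obtain xs ys where "xs \<in> lists X" "ys \<in> lists X" "s = sum_list xs" "t = sum_list ys"
      using st unfolding D_def by blast
    then show ?thesis unfolding D_def by (intro image_eqI[of _ _ "xs @ ys"]) auto
  qed
  moreover have "- s \<in> D" if s: "s \<in> D" for s
  proof -
    obtain xs where xs: "xs \<in> lists X" "s = sum_list xs" using s by (auto simp: D_def)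
    have "- y \<in> X" if "y \<in> X" for y using that by (auto simp: X_def)
    then have "map uminus (rev xs) \<in> lists X" using xs(1) by auto
    then show ?thesis unfolding D_def xs(2) minus_sum_list by (rule imageI)
  qed
  moreover have "S \<subseteq> D"
  proof
    fix s assume "s \<in> S"
    then show "s \<in> D" unfolding D_def by (intro image_eqI[of _ _ "[s]"]) (auto simp: X_def)
  qed
  ultimately show thesis by (intro that[of D]) (auto simp: countable_subgroup_def)
qed

text \<open>
  The integrand \<open>t \<mapsto> \<mu>(D t\<^sup>-\<^sup>1)\<close> equals \<open>\<mu>(D)\<close> for \<open>t \<in> D\<close>, as then \<open>D t\<^sup>-\<^sup>1 = D\<close>. For
  \<open>t \<notin> D\<close> it vanishes unless the countable set \<open>D t\<^sup>-\<^sup>1\<close> contains an atom of \<open>\<mu>\<close>. That happens only for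
  countably many \<open>t\<close>, and these are not atoms of \<open>\<nu>\<close>; so they form a null set.
\<close>

lemma convolve_countable_subgroup:
  fixes \<mu> \<nu> :: "'a::{topological_group_add, t2_space} set \<Rightarrow> complex"
  assumes \<mu>: "complex_borel_measure \<mu>" "radon (total_variation \<mu>)"
    and \<nu>: "complex_borel_measure \<nu>" "radon (total_variation \<nu>)"
    and D: "countable_subgroup D" and atoms: "atoms \<nu> \<subseteq> D"
  shows "convolve \<mu> \<nu> D = \<mu> D * \<nu> D"
proof -
  have Dc: "countable D" and add: "\<And>s t. s \<in> D \<Longrightarrow> t \<in> D \<Longrightarrow> s + t \<in> D"
    and minus: "\<And>s. s \<in> D \<Longrightarrow> - s \<in> D"
    using D by (auto simp: countable_subgroup_def)
  have Db: "D \<in> sets borel" using Dc by (rule countable_borel)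
  \<comment> \<open>the elements \<open>t\<close> outside \<open>D\<close> for which \<open>s + t \<in> D\<close> for some atom \<open>s\<close> of \<open>\<mu>\<close>\<close>
  define Z where "Z = (\<Union>s\<in>atoms \<mu>. (\<lambda>d. - s + d) ` D) - D"
  have "countable (\<Union>s\<in>atoms \<mu>. (\<lambda>d. - s + d) ` D)"
    using countable_atoms[OF \<mu>(1) radon_finite[OF \<mu>(2)]] Dc by (intro countable_UN countable_image)
  then have Z: "Z \<in> null_sets (total_variation \<nu>)"
    using atoms by (intro null_countable_without_atoms \<nu>) (auto simp: Z_def)
  have "complex_integral \<nu> (\<lambda>t. \<mu> {s. s + t \<in> D}) = \<mu> D * \<nu> D"
  proof (rule complex_integral_indicator[OF \<nu>(1) radon_finite[OF \<nu>(2)] _ Db Z])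
    show "(\<lambda>t. \<mu> {s. s + t \<in> D}) \<in> borel_measurable borel"
      by (rule measurable_complex_translate[OF \<mu> Db])
    fix t assume tZ: "t \<notin> Z"
    show "\<mu> {s. s + t \<in> D} = (if t \<in> D then \<mu> D else 0)"
    proof (cases "t \<in> D")
      case True
      have "s \<in> D" if "s + t \<in> D" for s
        using add[OF that minus[OF True]] by (simp add: add.assoc)
      then have "{s. s + t \<in> D} = D" using add True by blast
      then show ?thesis using True by simp
    next
      case False
      have "{s. s + t \<in> D} \<subseteq> (\<lambda>d. d - t) ` D" by (auto intro!: image_eqI[of _ _ "_ + t"])
      then have "countable {s. s + t \<in> D}" using Dc by (meson countable_image countable_subset)
      moreover have "s + t \<notin> D" if s: "s \<in> atoms \<mu>" for s
      proof
        assume "s + t \<in> D"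
        moreover have "t = - s + (s + t)" by (simp add: add.assoc[symmetric])
        ultimately have "t \<in> (\<Union>s\<in>atoms \<mu>. (\<lambda>d. - s + d) ` D)" using s by blast
        then show False using tZ False by (simp add: Z_def)
      qed
      ultimately have "\<mu> {s. s + t \<in> D} = 0"
        by (intro measure_zero_of_null null_countable_without_atoms \<mu>) auto
      then show ?thesis using False by simp
    qed
  qed
  then show ?thesis using Db by (simp add: convolve_def)
qed

text \<open>
  One countable subgroup containing the atoms of \<open>\<mu>\<close>, of \<open>\<nu>\<close> and of the product
  computes all three discrete masses.
\<close>

lemma discrete_mass_convolve:
  fixes \<mu> \<nu> :: "'a::{topological_group_add, t2_space} set \<Rightarrow> complex"
  assumes \<mu>: "complex_borel_measure \<mu>" "radon (total_variation \<mu>)"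
    and \<nu>: "complex_borel_measure \<nu>" "radon (total_variation \<nu>)"
    and conv: "emeasure (total_variation (convolve \<mu> \<nu>)) UNIV < \<infinity>"
  shows "discrete_mass (convolve \<mu> \<nu>) = discrete_mass \<mu> * discrete_mass \<nu>"
proof -
  note cbm = complex_borel_measure_convolve[OF \<mu> \<nu>]
  have "countable (atoms \<mu> \<union> atoms \<nu> \<union> atoms (convolve \<mu> \<nu>))"
    by (intro countable_Un countable_atoms[OF \<mu>(1) radon_finite[OF \<mu>(2)]]
        countable_atoms[OF \<nu>(1) radon_finite[OF \<nu>(2)]] countable_atoms[OF cbm conv])
  then obtain D where D: "countable_subgroup D" "atoms \<mu> \<union> atoms \<nu> \<union> atoms (convolve \<mu> \<nu>) \<subseteq> D"
    by (rule countable_subgroup_exists)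
  then have "countable D" by (simp add: countable_subgroup_def)
  then show ?thesis
    using convolve_countable_subgroup[OF \<mu> \<nu> D(1)] D(2)
      discrete_mass_eq[OF \<mu>(1), of D] discrete_mass_eq[OF \<nu>(1), of D] discrete_mass_eq[OF cbm, of D]
    by simp
qed

lemma discrete_mass_linear:
  fixes \<mu> \<nu> :: "'a::t2_space set \<Rightarrow> complex"
  assumes \<mu>: "complex_borel_measure \<mu>" "emeasure (total_variation \<mu>) UNIV < \<infinity>"
    and \<nu>: "complex_borel_measure \<nu>" "emeasure (total_variation \<nu>) UNIV < \<infinity>"
  shows "discrete_mass (\<lambda>E. c * \<mu> E + d * \<nu> E) = c * discrete_mass \<mu> + d * discrete_mass \<nu>"
proof -
  have cbm: "complex_borel_measure (\<lambda>E. c * \<mu> E + d * \<nu> E)"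
    using \<mu>(1) \<nu>(1) by (simp add: complex_borel_measure_def sums_add sums_mult)
  have "countable (atoms \<mu> \<union> atoms \<nu>)" using \<mu> \<nu> by (intro countable_Un countable_atoms)
  moreover have "atoms (\<lambda>E. c * \<mu> E + d * \<nu> E) \<subseteq> atoms \<mu> \<union> atoms \<nu>" by (auto simp: atoms_def)
  ultimately show ?thesis
    using discrete_mass_eq[OF \<mu>(1), of "atoms \<mu> \<union> atoms \<nu>"]
      discrete_mass_eq[OF \<nu>(1), of "atoms \<mu> \<union> atoms \<nu>"]
      discrete_mass_eq[OF cbm, of "atoms \<mu> \<union> atoms \<nu>"] by simp
qed

section \<open>Point masses\<close>

text \<open>
  Taken from \<open>return\<close> because \<open>measure\<close> vanishes on the sets that are not
  measurable, as a complex Borel measure has to.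
\<close>

definition dirac :: "'a::topological_space \<Rightarrow> 'a set \<Rightarrow> complex" where
  "dirac g E = of_real (measure (return borel g) E)"

lemma dirac_eq: "E \<in> sets borel \<Longrightarrow> dirac g E = (if g \<in> E then 1 else 0)"
  by (simp add: dirac_def measure_return)

lemma dirac_in_M_weighted:
  fixes g :: "'a::{topological_group_add, t2_space}"
  assumes \<omega>: "weight \<omega>"
  shows "dirac g \<in> M_weighted \<omega>"
proof -
  interpret R: prob_space "return borel g" by (rule prob_space_return) simp
  have cbm: "complex_borel_measure (dirac g)"
    unfolding complex_borel_measure_def dirac_def
    by (auto intro!: sums_of_real R.finite_measure_UNION simp: measure_notin_sets)
  have radon: "radon (return borel g)"
    unfolding radon_def
  proof (intro conjI ballI allI impI)
    fix E :: "'a set" and \<epsilon> :: real assume "E \<in> sets borel" "0 < \<epsilon>"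
    then show "\<exists>K. compact K \<and> K \<subseteq> E \<and> emeasure (return borel g) (E - K) \<le> ennreal \<epsilon>"
      by (intro exI[of _ "E \<inter> {g}"]) (auto simp: Int_insert_right)
  qed simp_all
  show ?thesis
  proof (rule M_weighted_dominated[OF \<omega> cbm radon radon, of 1 0])
    show "(\<integral>\<^sup>+ t. ennreal (\<omega> t) \<partial>return borel g) < \<infinity>"
      using weight_measurable[OF \<omega>] by (simp add: nn_integral_return)
    then show "(\<integral>\<^sup>+ t. ennreal (\<omega> t) \<partial>return borel g) < \<infinity>" .
    fix E :: "'a set" assume E: "E \<in> sets borel"
    have "emeasure (total_variation (dirac g)) E \<le> emeasure (return borel g) E"
    proof (rule total_variation_minimal[OF cbm E])
      fix A assume "A \<in> borel_partitions E"
      then have "(\<Sum>i. emeasure (return borel g) (A i)) = emeasure (return borel g) E"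
        by (auto simp: borel_partitions_def intro!: suminf_emeasure)
      then show "(\<Sum>i. ennreal (cmod (dirac g (A i)))) \<le> emeasure (return borel g) E"
        by (simp add: dirac_def R.emeasure_eq_measure)
    qed
    then show "emeasure (total_variation (dirac g)) E \<le>
        ennreal 1 * emeasure (return borel g) E + ennreal 0 * emeasure (return borel g) E" by simp
  qed simp_all
qed

lemma discrete_mass_dirac: "discrete_mass (dirac g) = 1" for g :: "'a::t2_space"
proof -
  have "atoms (dirac g) = {g}" by (auto simp: atoms_def dirac_eq)
  then show ?thesis by (simp add: discrete_mass_def dirac_eq)
qed

lemma convolve_dirac_left:
  fixes \<mu> :: "'a::{topological_group_add, t2_space} set \<Rightarrow> complex"
  assumes \<mu>: "complex_borel_measure \<mu>" "emeasure (total_variation \<mu>) UNIV < \<infinity>"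
  shows "convolve (dirac 0) \<mu> = \<mu>"
proof
  fix E
  show "convolve (dirac 0) \<mu> E = \<mu> E"
  proof (cases "E \<in> sets borel")
    case True
    have eq: "dirac 0 {s. s + t \<in> E} = indicator E t" for t
      using translate_borel[OF True, of t] by (simp add: dirac_eq)
    have "complex_integral \<mu> (indicator E) = 1 * \<mu> E"
      using True by (intro complex_integral_indicator[OF \<mu>, of _ _ "{}"]) auto
    then show ?thesis using True by (simp add: convolve_def eq)
  next
    case False
    then show ?thesis using \<mu>(1) unfolding complex_borel_measure_def convolve_def by auto
  qed
qed

lemma convolve_zero_left: "convolve 0 \<mu> = 0"
  by (auto simp: convolve_def fun_eq_iff complex_integral_def signed_integral_def)

section \<open>A maximal left ideal that is not finitely generated\<close>

text \<open>
  By homogeneity no singleton is open; hence if the group were countable, it would be a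
  countable union of closed sets with empty interior.
\<close>

lemma uncountable_nondiscrete_group:
  assumes lc: "locally_compact_space (euclidean :: 'a::{topological_group_add, t2_space} topology)"
    and nd: "\<not> discrete (UNIV :: 'a set)"
  shows "uncountable (UNIV :: 'a set)"
proof
  assume cnt: "countable (UNIV :: 'a set)"
  have not_open: "\<not> open {t}" for t :: 'a
  proof
    assume t: "open {t}"
    have "open {u}" for u :: 'a
    proof -
      have "s + (- u + t) = t \<longleftrightarrow> s = u" for s
      proof -
        have "s + (- u + t) = t \<longleftrightarrow> (s + - u) + t = 0 + t" by (simp only: add.assoc add_0)
        also have "\<dots> \<longleftrightarrow> s + - u = 0" by (rule add_right_cancel)
        finally show ?thesis by simp
      qed
      then have "{u} = {s. s + (- u + t) \<in> {t}}" by simp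
      then show ?thesis using open_translate[OF t, of "- u + t"] by simp
    qed
    then have "discrete (UNIV :: 'a set)" by (auto simp: discrete_def isolated_in_def)
    with nd show False by simp
  qed
  have reg: "regular_space (euclidean :: 'a topology)"
    using lc euclidean_Hausdorff locally_compact_Hausdorff_imp_regular_space by blast
  have "euclidean interior_of \<Union>(range (\<lambda>t::'a. {t})) = {}"
  proof (rule Baire_category_alt)
    show "completely_metrizable_space (euclidean :: 'a topology) \<or>
        locally_compact_space (euclidean :: 'a topology) \<and> regular_space (euclidean :: 'a topology)"
      using lc reg by blast
    show "countable (range (\<lambda>t::'a. {t}))" using cnt by (rule countable_image)
    fix T assume "T \<in> range (\<lambda>t::'a. {t})"
    then obtain t where T: "T = {t}" by blast
    have "interior {t} = {}"
      using not_open[of t] interior_subset[of "{t}"] open_interior[of "{t}"]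
      by (metis subset_singleton_iff)
    then show "closedin euclidean T \<and> euclidean interior_of T = {}" by (simp add: T)
  qed
  moreover have "\<Union>(range (\<lambda>t::'a. {t})) = UNIV" by auto
  ultimately show False by simp
qed

text \<open>
  The kernel of a nonzero multiplicative functional has codimension one.
\<close>

lemma maximal_left_ideal_discrete_mass:
  fixes \<omega> :: "'a::{topological_group_add, t2_space} \<Rightarrow> real"
  assumes lc: "locally_compact_space (euclidean :: 'a topology)" and \<omega>: "weight \<omega>"
  shows "maximal_left_ideal (M_weighted \<omega>) cscale convolve {\<mu> \<in> M_weighted \<omega>. discrete_mass \<mu> = 0}"
    (is "maximal_left_ideal ?A _ _ ?I")
proof -
  interpret V: vector_space cscale by (rule vector_space_cscale)
  note memb = M_weightedD[OF \<omega>]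
  have lin: "(\<lambda>E. c * \<mu> E + d * \<nu> E) \<in> ?A"
    "discrete_mass (\<lambda>E. c * \<mu> E + d * \<nu> E) = c * discrete_mass \<mu> + d * discrete_mass \<nu>"
    if "\<mu> \<in> ?A" "\<nu> \<in> ?A" for \<mu> \<nu> c d
    using that by (auto intro!: M_weighted_linear[OF \<omega>] discrete_mass_linear memb)
  have zero: "(0 :: 'a set \<Rightarrow> complex) = (\<lambda>E. 0 * dirac 0 E + 0 * dirac 0 E)" by (simp add: zero_fun_def)
  have dirac0: "dirac 0 \<in> ?A" by (rule dirac_in_M_weighted[OF \<omega>])
  have plus: "\<mu> + \<nu> = (\<lambda>E. 1 * \<mu> E + 1 * \<nu> E)" for \<mu> \<nu> :: "'a set \<Rightarrow> complex"
    by (simp add: plus_fun_def)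
  have scale: "cscale c \<mu> = (\<lambda>E. c * \<mu> E + 0 * \<mu> E)" for c and \<mu> :: "'a set \<Rightarrow> complex"
    by (simp add: cscale_def)
  have "V.subspace ?I"
    unfolding V.subspace_def
  proof (intro conjI ballI allI)
    show "0 \<in> ?I" unfolding zero using lin[OF dirac0 dirac0, of 0 0] by simp
    show "\<mu> + \<nu> \<in> ?I" if "\<mu> \<in> ?I" "\<nu> \<in> ?I" for \<mu> \<nu>
      unfolding plus using that lin[of \<mu> \<nu> 1 1] by simp
    show "cscale c \<mu> \<in> ?I" if "\<mu> \<in> ?I" for c \<mu>
      unfolding scale using that lin[of \<mu> \<mu> c 0] by simp
  qed
  moreover have "convolve a x \<in> ?I" if "a \<in> ?A" "x \<in> ?I" for a x
  proof -
    have x: "x \<in> ?A" "discrete_mass x = 0" using that(2) by auto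
    have c: "convolve a x \<in> ?A" by (rule M_weighted_convolve[OF lc \<omega> that(1) x(1)])
    have "discrete_mass (convolve a x) = discrete_mass a * discrete_mass x"
      by (intro discrete_mass_convolve memb that(1) x(1) c)
    with c x(2) show ?thesis by simp
  qed
  ultimately have ideal: "left_ideal ?A cscale convolve ?I"
    by (auto simp: left_ideal_def)
  have "dirac 0 \<notin> ?I" by (simp add: discrete_mass_dirac)
  then have proper: "?I \<noteq> ?A" using dirac0 by blast
  have "J = ?I \<or> J = ?A" if J: "left_ideal ?A cscale convolve J" "?I \<subseteq> J" for J
  proof (rule disjCI)
    assume "J \<noteq> ?A"
    have JA: "J \<subseteq> ?A" and sub: "V.subspace J" using J(1) by (simp_all add: left_ideal_def)
    show "J = ?I"
    proof (rule ccontr)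
      assume "J \<noteq> ?I"
      then obtain \<mu> where \<mu>: "\<mu> \<in> J" "discrete_mass \<mu> \<noteq> 0" using J(2) JA by blast
      have "\<nu> \<in> J" if \<nu>: "\<nu> \<in> ?A" for \<nu>
      proof -
        \<comment> \<open>subtracting the multiple of \<open>\<mu>\<close> with the same discrete mass moves \<open>\<nu>\<close> into the kernel\<close>
        define c where "c = discrete_mass \<nu> / discrete_mass \<mu>"
        have "(\<lambda>E. 1 * \<nu> E + (- c) * \<mu> E) \<in> ?I"
          using lin[OF \<nu>, of \<mu> 1 "- c"] \<mu> JA by (auto simp: c_def)
        then have "(\<lambda>E. 1 * \<nu> E + (- c) * \<mu> E) + cscale c \<mu> \<in> J"
          using J(2) \<mu>(1) by (intro V.subspace_add[OF sub] V.subspace_scale[OF sub]) auto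
        also have "(\<lambda>E. 1 * \<nu> E + (- c) * \<mu> E) + cscale c \<mu> = \<nu>"
          by (simp add: fun_eq_iff cscale_def)
        finally show ?thesis .
      qed
      with JA \<open>J \<noteq> ?A\<close> show False by blast
    qed
  qed
  with ideal proper show ?thesis by (simp add: maximal_left_ideal_def)
qed

lemma sum_fun_apply: "(\<Sum>i<n. f i) E = (\<Sum>i<n. f i E :: complex)" for n :: nat
  by (induction n) simp_all

text \<open>
  The generators see only a countable subgroup \<open>D\<close>: everything they generate vanishes on
  \<open>D\<close>, whereas the ideal contains \<open>\<delta>\<^sub>0 - \<delta>\<^sub>g\<close> for \<open>g\<close> outside \<open>D\<close>.
\<close>

lemma not_fin_gen_discrete_mass:
  fixes \<omega> :: "'a::{topological_group_add, t2_space} \<Rightarrow> real"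
  assumes \<omega>: "weight \<omega>" and unc: "uncountable (UNIV :: 'a set)"
  shows "\<not> fin_gen_left_ideal (M_weighted \<omega>) convolve {\<mu> \<in> M_weighted \<omega>. discrete_mass \<mu> = 0}"
proof
  let ?A = "M_weighted \<omega>"
  let ?I = "{\<mu> \<in> ?A. discrete_mass \<mu> = 0}"
  note memb = M_weightedD[OF \<omega>]
  assume "fin_gen_left_ideal ?A convolve ?I"
  then obtain n and x :: "nat \<Rightarrow> 'a set \<Rightarrow> complex" where
    x: "\<forall>i<n. x i \<in> ?A" and I: "?I = {\<Sum>i<n. convolve (a i) (x i) | a. \<forall>i<n. a i \<in> ?A}"
    unfolding fin_gen_left_ideal_def by blast
  have zero: "0 \<in> ?A"
    using M_weighted_linear[OF \<omega> dirac_in_M_weighted[OF \<omega>] dirac_in_M_weighted[OF \<omega>], of 0 0 0 0]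
    by (simp add: zero_fun_def)
  \<comment> \<open>each generator lies in the ideal, being its own combination with coefficient \<open>\<delta>\<^sub>0\<close>\<close>
  have x_mass: "discrete_mass (x j) = 0" if j: "j < n" for j
  proof -
    define a where "a i = (if i = j then dirac 0 else 0 :: 'a set \<Rightarrow> complex)" for i
    have xj: "x j \<in> ?A" using x j by blast
    have "convolve (dirac 0) (x j) = x j"
      by (rule convolve_dirac_left[OF memb(1,3)[OF xj]])
    then have "(\<Sum>i<n. convolve (a i) (x i)) = (\<Sum>i<n. if i = j then x j else 0)"
      by (intro sum.cong refl) (simp add: a_def convolve_zero_left)
    also have "\<dots> = x j" using j by simp
    finally have eq: "x j = (\<Sum>i<n. convolve (a i) (x i))" ..
    have "\<forall>i<n. a i \<in> ?A" using zero dirac_in_M_weighted[OF \<omega>] by (simp add: a_def)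
    then have "x j \<in> ?I" unfolding I using eq by blast
    then show ?thesis by simp
  qed
  have "countable (\<Union>i<n. atoms (x i))"
    using x by (intro countable_UN countable_atoms memb) auto
  then obtain D where D: "countable_subgroup D" "(\<Union>i<n. atoms (x i)) \<subseteq> D"
    by (rule countable_subgroup_exists)
  have Dc: "countable D" and D0: "0 \<in> D" using D(1) by (simp_all add: countable_subgroup_def)
  have vanish: "\<mu> D = 0" if \<mu>: "\<mu> \<in> ?I" for \<mu>
  proof -
    obtain a where a: "\<mu> = (\<Sum>i<n. convolve (a i) (x i))" "\<forall>i<n. a i \<in> ?A"
      using \<mu> unfolding I by blast
    have "convolve (a i) (x i) D = 0" if i: "i < n" for i
    proof -
      have "atoms (x i) \<subseteq> D" using D(2) i by auto
      then have "convolve (a i) (x i) D = a i D * x i D"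
        using a(2) x i by (intro convolve_countable_subgroup memb D(1)) auto
      moreover have "x i D = discrete_mass (x i)"
        using x i \<open>atoms (x i) \<subseteq> D\<close> by (intro discrete_mass_eq memb Dc) auto
      ultimately show ?thesis using x_mass[OF i] by simp
    qed
    then show ?thesis unfolding a(1) sum_fun_apply by simp
  qed
  obtain g where g: "g \<notin> D" using unc Dc by (metis UNIV_eq_I)
  let ?\<mu> = "\<lambda>E. 1 * dirac 0 E + (- 1) * dirac g E :: complex"
  note diracs = dirac_in_M_weighted[OF \<omega>, of 0] dirac_in_M_weighted[OF \<omega>, of g]
  have "?\<mu> \<in> ?A" by (rule M_weighted_linear[OF \<omega> diracs])
  moreover have "discrete_mass ?\<mu> = 1 * discrete_mass (dirac (0::'a)) + (- 1) * discrete_mass (dirac g)"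
    by (rule discrete_mass_linear[OF memb(1,3)[OF diracs(1)] memb(1,3)[OF diracs(2)]])
  ultimately have "?\<mu> \<in> ?I" by (simp add: discrete_mass_dirac)
  then have "?\<mu> D = 0" by (rule vanish)
  then show False using D0 g countable_borel[OF Dc] by (simp add: dirac_eq)
qed

theorem theorem3p7:
  fixes \<omega> :: "'a::{topological_group_add, t2_space} \<Rightarrow> real"
  assumes "locally_compact_space (euclidean :: 'a topology)"
    and "\<not> discrete (UNIV :: 'a set)"
    and "weight \<omega>"
    and "\<And>I. maximal_left_ideal (M_weighted \<omega>) cscale convolve I \<Longrightarrow>
           fin_gen_left_ideal (M_weighted \<omega>) convolve I"
  shows "finite_dimensional (M_weighted \<omega>) cscale"
  using assms(4)[OF maximal_left_ideal_discrete_mass[OF assms(1,3)]]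
    not_fin_gen_discrete_mass[OF assms(3) uncountable_nondiscrete_group[OF assms(1,2)]]
  by contradiction

end
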